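(* Let $\mathsf{E}_8\subset\mathbb{R}^8$ be the set of the 240 vectors $$\mathsf{E}_8=\{\pm e_i\pm e_j \mid 1\le i<j\le 8\}\cup\left\{\left(\pm\tfrac12,\ldots,\pm\tfrac12\right)\ \middle|\ \text{an even number of minus signs}\right\},$$ and let $\mathsf{E}_6=\{a\in\mathsf{E}_8\mid a_6=a_7=a_8\}$. Let $U=\{y\in\mathbb{R}^8\mid y_6=y_7=y_8\}$, and let $L:\mathbb{R}^6\to U$ be a linear isomorphism with $\|L(x)\|=\sqrt2\,\|x\|$ for all $x\in\mathbb{R}^6$; via $L$, identify $\mathsf{E}_6\subset U$ with the subset $L^{-1}(\mathsf{E}_6)$ of the unit sphere in $\mathbb{R}^6$. Let $J\subseteq\mathbb{R}[Y'_1,\ldots,Y'_6]$ be the ideal generated by the polynomials $N(L(Y'))$ and $C_b(L(Y'))$ for $b\in\mathsf{E}_8$ with $b_7-b_8=1$, where $N(Y)=\sum_{i=1}^8Y_i^2-2$ and $C_b(Y)=(b\cdot Y-1)(b\cdot Y)(b\cdot Y+1)$. Then: (i) $\mathcal{Z}(J)=\mathsf{E}_6$; (ii) $J$ is a radical ideal; (iii) the smallest degree of a non-trivial polynomial in $\mathcal{I}(\mathsf{E}_6)$ is three; (iv) $\mathcal{I}(\mathsf{E}_6)$ is generated by a set of polynomials all having degree three or less.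
   Context: $e_1,\ldots,e_8$ is the standard basis of $\mathbb{R}^8$, and $b\cdot Y=b_1Y_1+\cdots+b_8Y_8$. $\mathsf{E}_6$ is the set of shortest vectors of the $E_6$ root lattice. For a set $X\subseteq\mathbb{C}^6$, $\mathcal{I}(X)$ is the ideal of all polynomials in $\mathbb{C}[Y'_1,\ldots,Y'_6]$ vanishing at every point of $X$; for a set $S$ of polynomials, $\mathcal{Z}(S)$ is the set of all common zeros of $S$ in $\mathbb{C}^6$. Degree means total degree. A polynomial in $\mathbb{C}[Y'_1,\ldots,Y'_6]$ is trivial if it is divisible by $\sum_{i=1}^6 (Y'_i)^2-1$, and non-trivial otherwise. *)

theory Defs
  imports "HOL-Analysis.Analysis" "HOL-Library.Poly_Mapping"
begin

text \<open>
  Polynomials over \<open>'a\<close> in finitely many variables indexed by \<open>'n\<close>, as finitely supported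
  functions from exponent vectors to coefficients; the ring structure is the convolution
  product of \<^theory>\<open>HOL-Library.Poly_Mapping\<close>.
\<close>

type_synonym ('n, 'a) mpoly = "('n \<Rightarrow>\<^sub>0 nat) \<Rightarrow>\<^sub>0 'a"

definition Const :: "'a::zero \<Rightarrow> ('n, 'a) mpoly" where
  "Const c = Poly_Mapping.single 0 c"

definition Var :: "'n \<Rightarrow> ('n, 'a::zero_neq_one) mpoly" where
  "Var i = Poly_Mapping.single (Poly_Mapping.single i 1) 1"

definition poly_eval :: "('n::finite, 'a::comm_semiring_1) mpoly \<Rightarrow> 'a ^ 'n \<Rightarrow> 'a" where
  "poly_eval p x = (\<Sum>m\<in>Poly_Mapping.keys p.
     Poly_Mapping.lookup p m * (\<Prod>i\<in>UNIV. (x $ i) ^ Poly_Mapping.lookup m i))"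

text \<open>The total degree; the zero polynomial gets degree \<open>0\<close>.\<close>

definition total_degree :: "('n::finite, 'a::zero) mpoly \<Rightarrow> nat" where
  "total_degree p =
     Max (insert 0 ((\<lambda>m. \<Sum>i\<in>UNIV. Poly_Mapping.lookup m i) ` Poly_Mapping.keys p))"

definition complex_mpoly :: "('n, real) mpoly \<Rightarrow> ('n, complex) mpoly" where
  "complex_mpoly p = Poly_Mapping.map complex_of_real p"

definition complex_vec :: "real ^ 'n \<Rightarrow> complex ^ 'n" where
  "complex_vec x = (\<chi> i. complex_of_real (x $ i))"

text \<open>Ideals of a commutative ring are the submodules of the ring as a module over itself.\<close>

definition is_ideal :: "'a::comm_ring_1 set \<Rightarrow> bool" where
  "is_ideal I \<longleftrightarrow> module.subspace (*) I"

definition ideal_gen :: "'a::comm_ring_1 set \<Rightarrow> 'a set" where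
  "ideal_gen S = module.span (*) S"

definition radical_ideal :: "'a::comm_ring_1 set \<Rightarrow> bool" where
  "radical_ideal I \<longleftrightarrow> is_ideal I \<and> (\<forall>p n. p ^ n \<in> I \<longrightarrow> p \<in> I)"

definition vanishing_ideal :: "(complex ^ 'n::finite) set \<Rightarrow> ('n, complex) mpoly set" where
  "vanishing_ideal X = {p. \<forall>x\<in>X. poly_eval p x = 0}"

definition zero_set :: "('n::finite, complex) mpoly set \<Rightarrow> (complex ^ 'n) set" where
  "zero_set S = {x. \<forall>p\<in>S. poly_eval p x = 0}"

definition trivial_poly :: "(6, complex) mpoly \<Rightarrow> bool" where
  "trivial_poly p \<longleftrightarrow> (\<Sum>i\<in>UNIV. (Var i)\<^sup>2) - 1 dvd p"

text \<open>
  In the index type \<open>8\<close> the numerals \<open>1, \<dots>, 8\<close> denote its eight distinct elements,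
  with \<open>8 = 0\<close>.
\<close>

definition E8 :: "(real ^ 8) set" where
  "E8 = {s *\<^sub>R axis i 1 + t *\<^sub>R axis j 1 | s t i j. s \<in> {1, -1} \<and> t \<in> {1, -1} \<and> i \<noteq> j}
      \<union> {a. (\<forall>i. a $ i \<in> {1/2, -1/2}) \<and> even (card {i. a $ i = -1/2})}"

definition U_space :: "(real ^ 8) set" where
  "U_space = {y. y $ 6 = y $ 7 \<and> y $ 7 = y $ 8}"

definition E6 :: "(real ^ 8) set" where
  "E6 = {a \<in> E8. a $ 6 = a $ 7 \<and> a $ 7 = a $ 8}"

text \<open>The copy of \<open>E6\<close> in \<open>\<real>\<^sup>6\<close> obtained via \<open>L\<close>, regarded as a subset of \<open>\<complex>\<^sup>6\<close>.\<close>

definition E6_points :: "(real ^ 6 \<Rightarrow> real ^ 8) \<Rightarrow> (complex ^ 6) set" where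
  "E6_points L = complex_vec ` (L -` E6)"

text \<open>
  The polynomials \<open>N\<close> and \<open>C\<^sub>b\<close>, applied to an 8-tuple of polynomials, and the tuple
  \<open>L(Y')\<close> of linear forms, whose coefficients are the entries of the matrix of \<open>L\<close>.
\<close>

definition N_poly :: "(8 \<Rightarrow> ('n, real) mpoly) \<Rightarrow> ('n, real) mpoly" where
  "N_poly Y = (\<Sum>i\<in>UNIV. (Y i)\<^sup>2) - 2"

definition dot_poly :: "real ^ 8 \<Rightarrow> (8 \<Rightarrow> ('n, real) mpoly) \<Rightarrow> ('n, real) mpoly" where
  "dot_poly b Y = (\<Sum>i\<in>UNIV. Const (b $ i) * Y i)"

definition C_poly :: "real ^ 8 \<Rightarrow> (8 \<Rightarrow> ('n, real) mpoly) \<Rightarrow> ('n, real) mpoly" where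
  "C_poly b Y = (dot_poly b Y - 1) * dot_poly b Y * (dot_poly b Y + 1)"

definition linear_forms :: "(real ^ 6 \<Rightarrow> real ^ 8) \<Rightarrow> 8 \<Rightarrow> (6, real) mpoly" where
  "linear_forms L i = (\<Sum>j\<in>UNIV. Const (L (axis j 1) $ i) * Var j)"

definition ideal_J :: "(real ^ 6 \<Rightarrow> real ^ 8) \<Rightarrow> (6, real) mpoly set" where
  "ideal_J L = ideal_gen
     (insert (N_poly (linear_forms L))
        {C_poly b (linear_forms L) | b. b \<in> E8 \<and> b $ 7 - b $ 8 = 1})"

end

theory Submission
  imports Defs
begin

text \<open>The proof rests on one observation about the linear forms \<open>b \<cdot> Y\<close> with \<open>b = e\<^sub>7 + e\<^sub>k\<close>
(\<open>k \<le> 6\<close>): restricted to \<open>U\<close> they span all linear forms, and the cubics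
\<open>(b \<cdot> Y - 1)(b \<cdot> Y)(b \<cdot> Y + 1)\<close> that \<open>J\<close> contains for them are products of distinct linear
factors. Modulo these six cubics alone, the polynomial ring becomes the ring of functions on a
grid of \<open>3\<^sup>6\<close> points, so every larger ideal consists of all functions that vanish on some
subset of the grid. Hence an ideal containing these cubics contains every polynomial that vanishes
on its zero set (\<open>vanishing_imp_in_ideal\<close>). This holds over \<open>\<real>\<close> as well as over \<open>\<complex>\<close>, and no
Nullstellensatz is involved. Over \<open>\<real>\<close> it shows at once that \<open>J\<close> is radical; over \<open>\<complex>\<close>, applied to the ideal
generated by the polynomials of degree at most three in \<open>\<I>(E\<^sub>6)\<close>, it shows that these
generate \<open>\<I>(E\<^sub>6)\<close>.

For the zero set, the same forms take the values \<open>-1, 0, 1\<close> at a common zero, so that all common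
zeros are real, and it remains to see which \<open>y \<in> U\<close> with \<open>y \<cdot> y = 2\<close> satisfy
\<open>b \<cdot> y \<in> {-1, 0, 1}\<close> for all admissible \<open>b\<close>. Roots do, since two roots have an integral inner
product, which is \<open>\<plusminus>2\<close> only if they are proportional. Conversely, the roots \<open>e\<^sub>7 \<plusminus> e\<^sub>k\<close> force \<open>y\<close>
to be either an integral vector with two entries \<open>\<plusminus>1\<close> or a vector of entries \<open>\<plusminus>1/2\<close>, and
a half-integral root excludes the wrong parity of signs (\<open>U_root_test\<close>).

For the degree bound, a polynomial of degree at most two that vanishes on the roots splits into its
even and odd parts because \<open>E\<^sub>6 = -E\<^sub>6\<close>. The linear part vanishes, since the roots span. The
quadratic part takes the constant value \<open>-c\<close> on the roots, so adding \<open>c\<close> times the norm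
gives a symmetric bilinear form with \<open>g a a = 0\<close> for every root \<open>a\<close>. Polarization along sums and
differences of roots that are again roots makes \<open>g\<close> zero (\<open>symmetric_form_zero\<close>), so the polynomial
is \<open>c (1 - \<Sum> Y\<^sub>i\<^sup>2)\<close>. Degree three is attained by a cubic generator, which is not
divisible by \<open>\<Sum> Y\<^sub>i\<^sup>2 - 1\<close> because it is nonzero at the unit vector \<open>\<surd>2 u\<^sub>1\<close>, where \<open>L u\<^sub>1 = e\<^sub>1\<close>.\<close>

section \<open>Homomorphisms out of the polynomial ring\<close>

lemma mpoly_sum_singles: "p = (\<Sum>m\<in>Poly_Mapping.keys p. Poly_Mapping.single m (Poly_Mapping.lookup p m))"
  by (rule poly_mapping_eqI)
     (simp add: lookup_sum lookup_single when_def in_keys_iff)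

text \<open>Evaluation at a point and extension of scalars are both instances of this map, which is why it is
introduced: that they respect sums and products has to be proved only once.\<close>

definition hom_of :: "('a::comm_ring_1 \<Rightarrow> 'b::comm_ring_1) \<Rightarrow> (('n \<Rightarrow>\<^sub>0 nat) \<Rightarrow> 'b) \<Rightarrow> ('n, 'a) mpoly \<Rightarrow> 'b" where
  "hom_of h \<mu> p = (\<Sum>m\<in>Poly_Mapping.keys p. h (Poly_Mapping.lookup p m) * \<mu> m)"

locale coeff_mon_hom =
  fixes h :: "'a::comm_ring_1 \<Rightarrow> 'b::comm_ring_1" and \<mu> :: "('n \<Rightarrow>\<^sub>0 nat) \<Rightarrow> 'b"
  assumes h_add: "h (x + y) = h x + h y"
    and h_mult: "h (x * y) = h x * h y"
    and h_one: "h 1 = 1"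
    and mon_zero: "\<mu> 0 = 1"
    and mon_add: "\<mu> (m + m') = \<mu> m * \<mu> m'"
begin

lemma h_zero: "h 0 = 0"
  using h_add[of 0 0] by simp

lemma hom_of_superset:
  assumes "finite S" "Poly_Mapping.keys p \<subseteq> S"
  shows "hom_of h \<mu> p = (\<Sum>m\<in>S. h (Poly_Mapping.lookup p m) * \<mu> m)"
  unfolding hom_of_def using assms
  by (intro sum.mono_neutral_left) (auto simp: in_keys_iff h_zero)

lemma hom_of_add: "hom_of h \<mu> (p + q) = hom_of h \<mu> p + hom_of h \<mu> q"
proof -
  let ?S = "Poly_Mapping.keys p \<union> Poly_Mapping.keys q"
  have "hom_of h \<mu> r = (\<Sum>m\<in>?S. h (Poly_Mapping.lookup r m) * \<mu> m)" if "r \<in> {p, q, p + q}" for r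
    using that keys_add[of p q] by (intro hom_of_superset) auto
  then show ?thesis
    by (simp add: lookup_add h_add algebra_simps sum.distrib)
qed

lemma hom_of_zero: "hom_of h \<mu> 0 = 0"
  by (simp add: hom_of_def)

lemma hom_of_single: "hom_of h \<mu> (Poly_Mapping.single m c) = h c * \<mu> m"
  by (simp add: hom_of_def h_zero)

lemma hom_of_sum: "hom_of h \<mu> (sum f S) = (\<Sum>i\<in>S. hom_of h \<mu> (f i))"
  by (induction S rule: infinite_finite_induct) (auto simp: hom_of_zero hom_of_add)

lemma hom_of_mult: "hom_of h \<mu> (p * q) = hom_of h \<mu> p * hom_of h \<mu> q"
proof -
  let ?t = "\<lambda>p m. Poly_Mapping.single m (Poly_Mapping.lookup p m)"
  let ?K = "Poly_Mapping.keys"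
  have "hom_of h \<mu> (p * q) = hom_of h \<mu> ((\<Sum>m\<in>?K p. ?t p m) * (\<Sum>m\<in>?K q. ?t q m))"
    using mpoly_sum_singles[of p] mpoly_sum_singles[of q] by metis
  also have "\<dots> = (\<Sum>m\<in>?K p. \<Sum>m'\<in>?K q. hom_of h \<mu> (?t p m) * hom_of h \<mu> (?t q m'))"
    by (simp add: sum_product hom_of_sum mult_single hom_of_single h_mult mon_add algebra_simps)
  also have "\<dots> = (\<Sum>m\<in>?K p. hom_of h \<mu> (?t p m)) * (\<Sum>m'\<in>?K q. hom_of h \<mu> (?t q m'))"
    by (simp add: sum_product)
  also have "\<dots> = hom_of h \<mu> p * hom_of h \<mu> q"
    unfolding hom_of_single by (simp only: hom_of_def)
  finally show ?thesis .
qed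

lemma hom_of_one: "hom_of h \<mu> 1 = 1"
  using hom_of_single[of 0 1] by (simp add: h_one mon_zero)

end

definition mon_eval :: "'a::comm_ring_1 ^ 'n::finite \<Rightarrow> ('n \<Rightarrow>\<^sub>0 nat) \<Rightarrow> 'a" where
  "mon_eval x m = (\<Prod>i\<in>UNIV. (x $ i) ^ Poly_Mapping.lookup m i)"

lemma mon_eval_zero: "mon_eval x 0 = 1"
  by (simp add: mon_eval_def)

lemma mon_eval_add: "mon_eval x (m + m') = mon_eval x m * mon_eval x m'"
  by (simp add: mon_eval_def lookup_add power_add prod.distrib)

lemma mon_eval_var: "mon_eval x (Poly_Mapping.single i 1) = x $ i"
proof -
  have "mon_eval x (Poly_Mapping.single i 1) = (\<Prod>j\<in>UNIV. if j = i then x $ j else 1)"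
    unfolding mon_eval_def by (rule prod.cong) (auto simp: lookup_single when_def)
  then show ?thesis by simp
qed

lemma poly_eval_hom_of: "poly_eval p x = hom_of (\<lambda>c. c) (mon_eval x) p"
  by (simp add: poly_eval_def hom_of_def mon_eval_def)

interpretation ev: coeff_mon_hom "\<lambda>c::'a::comm_ring_1. c" "mon_eval (x :: 'a ^ 'n::finite)"
  by unfold_locales (auto simp: mon_eval_zero mon_eval_add)

lemma poly_eval_simps [simp]:
  fixes p q :: "('n::finite, 'a::comm_ring_1) mpoly"
  shows "poly_eval (p + q) x = poly_eval p x + poly_eval q x"
    and "poly_eval (p * q) x = poly_eval p x * poly_eval q x"
    and "poly_eval 0 x = 0" and "poly_eval 1 x = 1"
    and "poly_eval (Const c) x = c"
    and "poly_eval (Var i) x = x $ i"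
    and "poly_eval (sum f S) x = (\<Sum>i\<in>S. poly_eval (f i) x)"
  unfolding poly_eval_hom_of
       apply (rule ev.hom_of_add ev.hom_of_mult ev.hom_of_zero ev.hom_of_one ev.hom_of_sum)+
    apply (simp_all add: Const_def Var_def ev.hom_of_single mon_eval_zero mon_eval_var[unfolded One_nat_def] ev.hom_of_sum)
  done

lemma poly_eval_diff [simp]:
  fixes p q :: "('n::finite, 'a::comm_ring_1) mpoly"
  shows "poly_eval (- p) x = - poly_eval p x" "poly_eval (p - q) x = poly_eval p x - poly_eval q x"
proof -
  show *: "poly_eval (- p) x = - poly_eval p x" for p :: "('n, 'a) mpoly"
    using poly_eval_simps(1)[of p "- p" x] by (simp add: eq_neg_iff_add_eq_0 add.commute)
  show "poly_eval (p - q) x = poly_eval p x - poly_eval q x"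
    using poly_eval_simps(1)[of p "- q" x] * by simp
qed

lemma poly_eval_power [simp]:
  "poly_eval (p ^ n) x = poly_eval p x ^ n" for p :: "('n::finite, 'a::comm_ring_1) mpoly"
  by (induction n) auto

lemma Const_simps [simp]: "Const (0::'a::comm_ring_1) = 0" "Const (1::'a) = 1"
  "Const (a + b) = Const a + Const b" "Const (a - b) = Const a - Const b" "Const (a * b) = Const a * Const (b::'a)"
  "Const (- a) = - Const a"
  by (simp_all add: Const_def single_add single_diff mult_single single_uminus)

lemma Const_numeral: "Const (numeral n :: 'a::comm_ring_1) = numeral n"
  by (simp add: Const_def)

lemma poly_eval_numeral [simp]: "poly_eval (numeral n :: ('n::finite, 'a::comm_ring_1) mpoly) x = numeral n"
  using poly_eval_simps(5)[of "numeral n" x] by (simp only: Const_numeral)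

lemma Const_sum: "Const (sum f S) = (\<Sum>k\<in>S. Const (f k :: 'a::comm_ring_1))"
  by (induction S rule: infinite_finite_induct) simp_all

lemma lookup_complex_mpoly: "Poly_Mapping.lookup (complex_mpoly p) m = complex_of_real (Poly_Mapping.lookup p m)"
  unfolding complex_mpoly_def by transfer (simp add: when_def)

lemma keys_complex_mpoly: "Poly_Mapping.keys (complex_mpoly p) = Poly_Mapping.keys p"
  by (auto simp: in_keys_iff lookup_complex_mpoly)

lemma total_degree_complex_mpoly: "total_degree (complex_mpoly p) = total_degree p"
  by (simp add: total_degree_def keys_complex_mpoly)

lemma complex_mpoly_hom_of:
  "complex_mpoly p = hom_of (\<lambda>c. Const (complex_of_real c)) (\<lambda>m. Poly_Mapping.single m 1) p"
  by (rule poly_mapping_eqI)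
     (simp add: hom_of_def lookup_complex_mpoly Const_def mult_single lookup_sum lookup_single when_def in_keys_iff)

interpretation cm: coeff_mon_hom "\<lambda>c. Const (complex_of_real c)" "\<lambda>m. Poly_Mapping.single m 1"
  by unfold_locales (auto simp: mult_single)

lemma complex_mpoly_simps [simp]:
  "complex_mpoly (p + q) = complex_mpoly p + complex_mpoly q"
  "complex_mpoly (p * q) = complex_mpoly p * complex_mpoly q"
  "complex_mpoly 0 = 0" "complex_mpoly 1 = 1"
  "complex_mpoly (sum f S) = (\<Sum>i\<in>S. complex_mpoly (f i))"
  "complex_mpoly (Const c) = Const (complex_of_real c)"
  "complex_mpoly (Var i) = Var i"
  unfolding complex_mpoly_hom_of
       apply (rule cm.hom_of_add cm.hom_of_mult cm.hom_of_zero cm.hom_of_one cm.hom_of_sum)+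
    apply (simp_all add: cm.hom_of_single[unfolded Const_def] Const_def Var_def cm.hom_of_sum mult_single)
  done

lemma complex_mpoly_diff [simp]:
  "complex_mpoly (p - q) = complex_mpoly p - complex_mpoly q"
  using complex_mpoly_simps(1)[of "p - q" q] by (simp add: eq_diff_eq)

lemma poly_eval_complex_vec: "poly_eval (complex_mpoly p) (complex_vec x) = complex_of_real (poly_eval p x)"
  by (simp add: poly_eval_def keys_complex_mpoly lookup_complex_mpoly complex_vec_def)

section \<open>Ideals containing split polynomials in a spanning set of forms\<close>

text \<open>Writing the ring as a module over itself makes the library's span available for ideals. The module
facts are instantiated one by one: an interpretation would add the rule that rewrites
\<open>a * (b * x)\<close> to \<open>a * b * x\<close> to the simplifier, against the associativity rule for products.\<close>

lemma ideal_module: "module ((*) :: 'a::comm_ring_1 \<Rightarrow> 'a \<Rightarrow> 'a)"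
  by unfold_locales (auto simp: algebra_simps)

lemma is_idealD:
  assumes "is_ideal J"
  shows "0 \<in> J" and "x \<in> J \<Longrightarrow> y \<in> J \<Longrightarrow> x + y \<in> J" and "x \<in> J \<Longrightarrow> y \<in> J \<Longrightarrow> x - y \<in> J"
    and "x \<in> J \<Longrightarrow> r * x \<in> J" and "x \<in> J \<Longrightarrow> x * r \<in> J"
  using assms module.subspace_0[OF ideal_module] module.subspace_add[OF ideal_module] module.subspace_diff[OF ideal_module] module.subspace_scale[OF ideal_module]
  by (auto simp: is_ideal_def mult.commute[of x r])

lemma is_ideal_ideal_gen: "is_ideal (ideal_gen S)"
  by (simp add: is_ideal_def ideal_gen_def module.subspace_span[OF ideal_module])

lemma ideal_gen_superset: "x \<in> S \<Longrightarrow> x \<in> ideal_gen S"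
  by (simp add: ideal_gen_def module.span_base[OF ideal_module])

lemma ideal_gen_minimal: "S \<subseteq> J \<Longrightarrow> is_ideal J \<Longrightarrow> ideal_gen S \<subseteq> J"
  by (simp add: ideal_gen_def is_ideal_def module.span_minimal[OF ideal_module])

lemma is_idealI:
  assumes "0 \<in> J" "\<And>x y. x \<in> J \<Longrightarrow> y \<in> J \<Longrightarrow> x + y \<in> J" "\<And>r x. x \<in> J \<Longrightarrow> r * x \<in> J"
  shows "is_ideal J"
  using assms by (simp add: is_ideal_def module.subspace_def[OF ideal_module])

abbreviation scale :: "'a::comm_ring_1 \<Rightarrow> ('n, 'a) mpoly \<Rightarrow> ('n, 'a) mpoly" where
  "scale c p \<equiv> Const c * p"

lemma coeff_module: "module (scale :: 'a::comm_ring_1 \<Rightarrow> ('n, 'a) mpoly \<Rightarrow> _)"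
  by unfold_locales (auto simp: algebra_simps)

text \<open>The polynomial ring is generated as a ring by constants and variables, so an identity between
ring homomorphisms, or a congruence modulo an ideal, has to be checked only on these.\<close>

lemma mpoly_induct [case_names Const Var add mult]:
  fixes p :: "('n::finite, 'a::comm_ring_1) mpoly"
  assumes C: "\<And>c. P (Const c)" and V: "\<And>i. P (Var i)"
    and A: "\<And>p q. P p \<Longrightarrow> P q \<Longrightarrow> P (p + q)" and M: "\<And>p q. P p \<Longrightarrow> P q \<Longrightarrow> P (p * q)"
  shows "P p"
proof -
  have one: "P 1" and zero: "P 0"
    using C[of 1] C[of 0] by simp_all
  have pow: "P (Var i ^ n)" for i n
    by (induction n) (auto intro: one M V)
  have mon: "P (\<Prod>i\<in>I. Var i ^ Poly_Mapping.lookup m i)" for I m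
    by (induction I rule: infinite_finite_induct) (auto intro: one M pow)
  have pow_eq: "Var i ^ n = (Poly_Mapping.single (Poly_Mapping.single i n) 1 :: ('n, 'a) mpoly)" for i n
    by (induction n) (simp_all add: Var_def mult_single flip: single_add)
  have prod_eq: "(\<Prod>i\<in>I. Var i ^ Poly_Mapping.lookup m i) =
      (Poly_Mapping.single (\<Sum>i\<in>I. Poly_Mapping.single i (Poly_Mapping.lookup m i)) 1 :: ('n, 'a) mpoly)"
    if "finite I" for I m
    using that by (induction I rule: finite_induct) (simp_all add: pow_eq mult_single)
  have mon_eq: "(\<Sum>i\<in>UNIV. Poly_Mapping.single i (Poly_Mapping.lookup m i)) = m" for m :: "'n \<Rightarrow>\<^sub>0 nat"
    by (rule poly_mapping_eqI) (simp add: lookup_sum lookup_single when_def)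
  have single: "P (Poly_Mapping.single m c)" for m c
  proof -
    have "Poly_Mapping.single m c = Const c * (\<Prod>i\<in>UNIV. Var i ^ Poly_Mapping.lookup m i)"
      by (simp add: prod_eq mon_eq Const_def mult_single)
    then show ?thesis
      using M[OF C mon] by metis
  qed
  have "P (\<Sum>m\<in>S. Poly_Mapping.single m (Poly_Mapping.lookup p m))" for S
    by (induction S rule: infinite_finite_induct) (auto intro: zero A single)
  then show ?thesis
    using mpoly_sum_singles[of p] by metis
qed

text \<open>If \<open>A\<close> is a finite set of constants, the products over \<open>A - {a}\<close> generate the unit ideal: they
are the Lagrange basis up to units. Explicit interpolation is avoided by removing one constant
\<open>c\<close> at a time. Induction applied to \<open>q * (F - c)\<close> shows that \<open>F\<close> acts on \<open>q\<close> as the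
constant \<open>c\<close> modulo \<open>J\<close>; then the remaining product acts on \<open>q\<close> as the unit
\<open>\<Prod>b\<in>A. c - b\<close>.\<close>

lemma ideal_split_step:
  fixes F :: "('n::finite, 'a::field) mpoly"
  assumes J: "is_ideal J" and "finite A" "A \<noteq> {}"
    and "\<And>a. a \<in> A \<Longrightarrow> q * (\<Prod>b\<in>A - {a}. F - Const b) \<in> J"
  shows "q \<in> J"
  using assms(2-)
proof (induction A arbitrary: q rule: finite_ne_induct)
  case (singleton a)
  then show ?case by simp
next
  case (insert c A)
  have root: "q * (F - Const c) \<in> J"
  proof (rule insert.IH)
    fix a assume "a \<in> A"
    then have eq: "insert c A - {a} = insert c (A - {a})" and "c \<notin> A - {a}" "finite (A - {a})"
      using insert.hyps by auto
    have "q * (\<Prod>b\<in>insert c A - {a}. F - Const b) \<in> J"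
      using insert.prems \<open>a \<in> A\<close> by blast
    then show "q * (F - Const c) * (\<Prod>b\<in>A - {a}. F - Const b) \<in> J"
      unfolding eq prod.insert[OF \<open>finite (A - {a})\<close> \<open>c \<notin> A - {a}\<close>] by (simp only: mult.assoc)
  qed
  \<comment> \<open>Since \<open>q * (F - c)\<close> lies in \<open>J\<close>, the form \<open>F\<close> may be replaced by \<open>c\<close> in multiples of \<open>q\<close>.\<close>
  have identity: "q * ((F - Const b) * P) - Const ((c - b) * u) * q
      = P * (q * (F - Const c)) + Const (c - b) * (q * P - Const u * q)" for b u P
    by (simp add: algebra_simps)
  have subst: "q * (\<Prod>b\<in>B. F - Const b) - Const (\<Prod>b\<in>B. c - b) * q \<in> J" for B
  proof (induction B rule: infinite_finite_induct)
    case (insert b B)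
    have "q * (\<Prod>b\<in>insert b B. F - Const b) - Const (\<Prod>b\<in>insert b B. c - b) * q
        = (\<Prod>b\<in>B. F - Const b) * (q * (F - Const c))
          + Const (c - b) * (q * (\<Prod>b\<in>B. F - Const b) - Const (\<Prod>b\<in>B. c - b) * q)"
      unfolding prod.insert[OF insert.hyps] by (rule identity)
    then show ?case
      using is_idealD(2)[OF J is_idealD(4)[OF J root] is_idealD(4)[OF J insert.IH]] by simp
  qed (simp_all add: is_idealD(1)[OF J])
  let ?u = "\<Prod>b\<in>A. c - b"
  have "insert c A - {c} = A"
    using insert.hyps by auto
  then have "q * (\<Prod>b\<in>A. F - Const b) \<in> J"
    using insert.prems[of c] by simp
  then have "q * (\<Prod>b\<in>A. F - Const b) - (q * (\<Prod>b\<in>A. F - Const b) - Const ?u * q) \<in> J"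
    using subst[of A] is_idealD(3)[OF J] by blast
  then have "Const ?u * q \<in> J"
    by simp
  then have "Const (inverse ?u) * (Const ?u * q) \<in> J"
    by (rule is_idealD(4)[OF J])
  moreover have "?u \<noteq> 0"
    using insert.hyps by auto
  ultimately show ?case
    by (simp only: mult.assoc[symmetric] Const_simps(5)[symmetric]) simp
qed

text \<open>The several-variable version: each \<open>g\<close> is a point of the grid \<open>Fs \<rightarrow> A\<close>, and the product attached
to it is, up to a unit, the function that is one at this point and zero at all others.\<close>

lemma ideal_split:
  fixes Fs :: "('n::finite, 'a::field) mpoly set"
  assumes J: "is_ideal J" and A: "finite A" "A \<noteq> {}" and "finite Fs"
    and "\<And>g. g \<in> Fs \<rightarrow> A \<Longrightarrow> q * (\<Prod>F\<in>Fs. \<Prod>b\<in>A - {g F}. F - Const b) \<in> J"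
  shows "q \<in> J"
  using assms(4-)
proof (induction Fs arbitrary: q rule: finite_induct)
  case empty
  then show ?case by simp
next
  case (insert F Fs)
  show ?case
  proof (rule ideal_split_step[OF J A], rule insert.IH)
    fix a g assume "a \<in> A" "g \<in> Fs \<rightarrow> A"
    then have "g(F := a) \<in> insert F Fs \<rightarrow> A"
      by auto
    note upd = insert.prems[OF this]
    have "(\<Prod>G\<in>Fs. \<Prod>b\<in>A - {(g(F := a)) G}. G - Const b) = (\<Prod>G\<in>Fs. \<Prod>b\<in>A - {g G}. G - Const b)"
      using insert.hyps by (intro prod.cong) auto
    then show "q * (\<Prod>b\<in>A - {a}. F - Const b) * (\<Prod>F\<in>Fs. \<Prod>b\<in>A - {g F}. F - Const b) \<in> J"
      using upd by (simp only: prod.insert[OF insert.hyps] fun_upd_same mult.assoc)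
  qed
qed

text \<open>Modulo the given split polynomials, the product \<open>l\<close> attached to a grid point \<open>g\<close> satisfies
\<open>F l = g(F) l\<close> for every \<open>F\<close>; since the \<open>F\<close> span the variables, \<open>f l = f(x) l\<close> for every
polynomial \<open>f\<close>, where \<open>x\<close> is the point with coordinates determined by \<open>g\<close>. If \<open>x\<close> is a zero of
\<open>J\<close> then \<open>p(x) = 0\<close> and \<open>p l\<close> lies in \<open>J\<close>. Otherwise some \<open>f \<in> J\<close> has \<open>f(x) \<noteq> 0\<close>, and
already \<open>l\<close> lies in \<open>J\<close>.\<close>

theorem vanishing_imp_in_ideal:
  fixes p :: "('n::finite, 'a::field) mpoly"
  assumes J: "is_ideal J" and A: "finite A" "A \<noteq> {}" and Fs: "finite Fs"
    and split: "\<And>F. F \<in> Fs \<Longrightarrow> (\<Prod>a\<in>A. F - Const a) \<in> J"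
    and vars: "\<And>i. Var i \<in> module.span scale Fs"
    and van: "\<And>x. (\<And>f. f \<in> J \<Longrightarrow> poly_eval f x = 0) \<Longrightarrow> poly_eval p x = 0"
  shows "p \<in> J"
proof (rule ideal_split[OF J A Fs])
  fix g assume g: "g \<in> Fs \<rightarrow> A"
  define l where "l = (\<Prod>F\<in>Fs. \<Prod>b\<in>A - {g F}. F - Const b)"
  note J' = is_idealD[OF J]
  let ?S = "{f. \<exists>c. l * f - Const c * l \<in> J}"
  have base: "F \<in> ?S" if "F \<in> Fs" for F
  proof -
    have "g F \<in> A"
      using g that by blast
    have "l = (\<Prod>b\<in>A - {g F}. F - Const b) * (\<Prod>F\<in>Fs - {F}. \<Prod>b\<in>A - {g F}. F - Const b)"
      unfolding l_def by (rule prod.remove[OF Fs that])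
    moreover have "(\<Prod>a\<in>A. F - Const a) = (F - Const (g F)) * (\<Prod>b\<in>A - {g F}. F - Const b)"
      by (rule prod.remove[OF A(1) \<open>g F \<in> A\<close>])
    moreover have "P * R * F - Const (g F) * (P * R) = (F - Const (g F)) * P * R" for P R
      by (simp add: algebra_simps)
    ultimately have "l * F - Const (g F) * l = (\<Prod>a\<in>A. F - Const a) * (\<Prod>F\<in>Fs - {F}. \<Prod>b\<in>A - {g F}. F - Const b)"
      by (simp only:)
    then have "l * F - Const (g F) * l \<in> J"
      using J'(5)[OF split[OF that]] by (simp only:)
    then show ?thesis
      by blast
  qed
  have "module.subspace scale ?S"
  proof (rule module.subspaceI[OF coeff_module])
    show "0 \<in> ?S"
      using J'(1) by (auto intro!: exI[of _ 0])
    show "f + h \<in> ?S" if "f \<in> ?S" "h \<in> ?S" for f h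
    proof -
      from that obtain c d where "l * f - Const c * l \<in> J" "l * h - Const d * l \<in> J"
        by blast
      then have "l * f - Const c * l + (l * h - Const d * l) \<in> J"
        by (rule J'(2))
      then show ?thesis
        by (auto simp: algebra_simps intro!: exI[of _ "c + d"])
    qed
    show "Const c * f \<in> ?S" if "f \<in> ?S" for c f
    proof -
      from that obtain d where "l * f - Const d * l \<in> J"
        by blast
      then have "Const c * (l * f - Const d * l) \<in> J"
        by (rule J'(4))
      then show ?thesis
        by (auto simp: algebra_simps intro!: exI[of _ "c * d"])
    qed
  qed
  then have "module.span scale Fs \<subseteq> ?S"
    using base by (intro module.span_minimal[OF coeff_module]) auto
  then have "\<exists>c. l * Var i - Const c * l \<in> J" for i
    using vars[of i] by blast
  then obtain c where c: "\<And>i. l * Var i - Const (c i) * l \<in> J"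
    by metis
  define x where "x = (\<chi> i. c i)"
  have reduce: "l * f - Const (poly_eval f x) * l \<in> J" for f
  proof (induction f rule: mpoly_induct)
    case (Const a)
    then show ?case using J'(1) by (simp add: mult.commute)
  next
    case (Var i)
    then show ?case using c by (simp add: x_def)
  next
    case (add f h)
    then show ?case using J'(2)[OF add] by (simp add: algebra_simps)
  next
    case (mult f h)
    have "l * (f * h) - Const (poly_eval (f * h) x) * l
        = h * (l * f - Const (poly_eval f x) * l) + Const (poly_eval f x) * (l * h - Const (poly_eval h x) * l)"
      by (simp add: algebra_simps)
    then show ?case using J'(2)[OF J'(4)[OF mult(1)] J'(4)[OF mult(2)]] by simp
  qed
  show "p * l \<in> J"
  proof (cases "\<forall>f\<in>J. poly_eval f x = 0")
    case True
    then show ?thesis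
      using reduce[of p] van[of x] by (simp add: mult.commute)
  next
    case False
    then obtain f where f: "f \<in> J" "poly_eval f x \<noteq> 0"
      by blast
    have "l * f - (l * f - Const (poly_eval f x) * l) \<in> J"
      using J'(3)[OF J'(4)[OF f(1)] reduce] .
    then have "Const (inverse (poly_eval f x)) * (Const (poly_eval f x) * l) \<in> J"
      using J'(4) by simp
    then have "l \<in> J"
      using f(2) by (simp only: mult.assoc[symmetric] Const_simps(5)[symmetric]) simp
    then show ?thesis
      by (rule J'(4))
  qed
qed

lemma is_ideal_kernel:
  assumes "\<phi> 0 = 0" "\<And>p q. \<phi> (p + q) = \<phi> p + \<phi> q" "\<And>p q. \<phi> (p * q) = \<phi> p * \<phi> q"
  shows "is_ideal {p. \<phi> p = (0::'b::comm_ring_1)}"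
  by (rule is_idealI) (auto simp: assms)

lemma is_ideal_vanishing_ideal: "is_ideal (vanishing_ideal X)"
  by (rule is_idealI) (auto simp: vanishing_ideal_def)

lemma complex_mpoly_span:
  assumes "p \<in> module.span scale S"
  shows "complex_mpoly p \<in> module.span scale (complex_mpoly ` S)"
proof -
  have "module.subspace scale {p. complex_mpoly p \<in> module.span scale (complex_mpoly ` S)}"
    by (rule module.subspaceI[OF coeff_module])
       (auto intro: module.span_zero[OF coeff_module] module.span_add[OF coeff_module] module.span_scale[OF coeff_module])
  then show ?thesis
    using assms module.span_minimal[OF coeff_module, of S "{p. complex_mpoly p \<in> module.span scale (complex_mpoly ` S)}"]
    by (auto intro: module.span_base[OF coeff_module])
qed

section \<open>Inner products of roots\<close>

lemma UNIV_8: "(UNIV :: 8 set) = {1, 2, 3, 4, 5, 6, 7, 8}"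
proof -
  have "x \<in> {1, 2, 3, 4, 5, 6, 7, 8}" for x :: 8
  proof (induct x)
    case (of_int z)
    then have "z = 0 \<or> z = 1 \<or> z = 2 \<or> z = 3 \<or> z = 4 \<or> z = 5 \<or> z = 6 \<or> z = 7" by fastforce
    then show ?case by auto
  qed
  then show ?thesis by auto
qed

lemma sum_8: "sum f (UNIV :: 8 set) = f 1 + f 2 + f 3 + f 4 + f 5 + f 6 + f 7 + f 8"
  unfolding UNIV_8 by (simp add: ac_simps)

lemma inner_8: "(x :: real ^ 8) \<bullet> y = (\<Sum>i\<in>UNIV. x $ i * y $ i)"
  by (simp add: inner_vec_def)

lemma halfE:
  assumes "x \<in> {1/2, -1/2 :: real}"
  obtains u where "x = u / 2" "u \<in> {1, -1}"
  using that[of "2 * x"] assms by auto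

lemma half_square: "x \<in> {1/2, -1/2 :: real} \<Longrightarrow> x * x = 1/4"
  by (elim insertE emptyE; hypsubst; simp)

lemma half_of_bool: "x \<in> {1/2, -1/2 :: real} \<Longrightarrow> x = 1/2 - of_bool (x = -1/2)"
  by (elim insertE emptyE; hypsubst; simp)

lemma sum_of_bool_UNIV: "(\<Sum>i\<in>UNIV. of_bool (P i)) = real (card {i::'n::finite. P i})"
  by (simp add: of_bool_def sum.If_cases)

text \<open>The only case that uses the parity of signs is that of two half-integral roots. Writing the
entries as \<open>1/2 - \<alpha> i\<close> and \<open>1/2 - \<beta> i\<close> with indicator functions of the minus signs, the
inner product is \<open>2\<close> minus half the number of minus signs of each root plus the number of common
ones.\<close>

lemma E8_inner_Ints:
  assumes "a \<in> E8" "b \<in> E8"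
  shows "a \<bullet> b \<in> \<int>"
proof -
  let ?R = "{s *\<^sub>R axis i 1 + t *\<^sub>R axis j 1 | s t i j. s \<in> {1, -1} \<and> t \<in> {1, -1} \<and> i \<noteq> j} :: (real ^ 8) set"
  let ?H = "{a :: real ^ 8. (\<forall>i. a $ i \<in> {1/2, -1/2}) \<and> even (card {i. a $ i = -1/2})}"
  have R: "a \<bullet> b \<in> \<int>" if "a \<in> ?R" "b \<in> ?R \<or> b \<in> ?H" for a b
  proof -
    from that obtain s t :: real and i j where a: "a = s *\<^sub>R axis i 1 + t *\<^sub>R axis j 1" "s \<in> {1, -1}" "t \<in> {1, -1}"
      by blast
    have ab: "a \<bullet> b = s * b $ i + t * b $ j"
      by (simp add: a(1) inner_add_left inner_axis')
    show ?thesis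
    proof (cases "b \<in> ?R")
      case True
      then have "b $ k \<in> \<int>" for k
        by (auto simp: axis_def)
      then show ?thesis
        using a unfolding ab by auto
    next
      case False
      then have "b $ i \<in> {1/2, -1/2}" "b $ j \<in> {1/2, -1/2}"
        using that(2) by auto
      then obtain u v where uv: "b $ i = u / 2" "u \<in> {1, -1}" "b $ j = v / 2" "v \<in> {1, -1}"
        by (metis halfE)
      have "s * (u / 2) + t * (v / 2) \<in> \<int>"
        using a(2,3) uv(2,4) by auto
      then show ?thesis
        by (simp only: ab uv(1,3))
    qed
  qed
  have H: "a \<bullet> b \<in> \<int>" if a: "a \<in> ?H" and b: "b \<in> ?H" for a b
  proof -
    let ?A = "{i. a $ i = -1/2}" and ?B = "{i. b $ i = -1/2}"
    from a b obtain m n where mn: "card ?A = 2 * m" "card ?B = 2 * n"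
      by (auto elim!: evenE)
    define \<alpha> \<beta> :: "8 \<Rightarrow> real" where "\<alpha> i = of_bool (a $ i = -1/2)" and "\<beta> i = of_bool (b $ i = -1/2)" for i
    have "a $ i = 1/2 - \<alpha> i" "b $ i = 1/2 - \<beta> i" for i
      unfolding \<alpha>_def \<beta>_def using a b by (blast intro: half_of_bool)+
    moreover have "(1/2 - x) * (1/2 - y) = 1/4 - x / 2 - y / 2 + x * y" for x y :: real
      by (simp add: algebra_simps)
    ultimately have "a \<bullet> b = (\<Sum>i\<in>UNIV. 1/4 - \<alpha> i / 2 - \<beta> i / 2 + \<alpha> i * \<beta> i)"
      by (simp only: inner_8)
    also have "\<dots> = 2 - sum \<alpha> UNIV / 2 - sum \<beta> UNIV / 2 + (\<Sum>i\<in>UNIV. \<alpha> i * \<beta> i)"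
      by (simp add: sum.distrib sum_subtractf sum_divide_distrib[symmetric])
    also have "\<dots> = 2 - real (card ?A) / 2 - real (card ?B) / 2 + real (card {i. a $ i = -1/2 \<and> b $ i = -1/2})"
      unfolding \<alpha>_def \<beta>_def of_bool_conj[symmetric] sum_of_bool_UNIV ..
    also have "\<dots> = of_int (2 - int m - int n + int (card {i. a $ i = -1/2 \<and> b $ i = -1/2}))"
      unfolding mn by simp
    finally show ?thesis
      by (simp only: Ints_of_int)
  qed
  have b: "b \<in> ?R \<or> b \<in> ?H"
    by (rule assms(2)[unfolded E8_def Un_iff])
  have "a \<in> ?R \<or> a \<in> ?H"
    by (rule assms(1)[unfolded E8_def Un_iff])
  then show ?thesis
  proof
    assume "a \<in> ?R"
    from R[OF this b] show ?thesis .
  next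
    assume a: "a \<in> ?H"
    from b show ?thesis
    proof
      assume "b \<in> ?R"
      from R[OF this disjI2[OF a]] show ?thesis
        by (subst inner_commute)
    qed (rule H[OF a])
  qed
qed

lemma E8_norm:
  assumes "a \<in> E8"
  shows "a \<bullet> a = 2"
proof -
  consider s t :: real and i j where "a = s *\<^sub>R axis i 1 + t *\<^sub>R axis j 1" "s \<in> {1, -1}" "t \<in> {1, -1}" "i \<noteq> j"
    | "\<forall>i. a $ i \<in> {1/2, -1/2}"
    using assms unfolding E8_def by blast
  then show ?thesis
  proof cases
    case 1
    then show ?thesis
      by (auto simp: inner_add_left inner_add_right inner_axis_axis)
  next
    case 2
    have "a $ i * a $ i = 1/4" for i
      using 2 by (intro half_square) blast
    then show ?thesis
      by (simp only: inner_8) simp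
  qed
qed

text \<open>The inner product is an integer, and the squared norms \<open>4 - 2 (a \<bullet> b)\<close> of \<open>a - b\<close> and
\<open>4 + 2 (a \<bullet> b)\<close> of \<open>a + b\<close> are positive.\<close>

lemma E8_inner_cases:
  assumes "a \<in> E8" "b \<in> E8" "a \<noteq> b" "a \<noteq> - b"
  shows "a \<bullet> b \<in> {-1, 0, 1}"
proof -
  obtain k where k: "a \<bullet> b = of_int k"
    using E8_inner_Ints[OF assms(1,2)] by (elim Ints_cases)
  have "0 < (a - b) \<bullet> (a - b)" "0 < (a + b) \<bullet> (a + b)"
    using assms(3,4) by (simp_all add: inner_gt_zero_iff eq_neg_iff_add_eq_0)
  then have "a \<bullet> b < 2" "- 2 < a \<bullet> b"
    using E8_norm[OF assms(1)] E8_norm[OF assms(2)]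
    by (simp_all add: inner_diff_left inner_diff_right inner_add_left inner_add_right inner_commute)
  then have "k \<in> {-1, 0, 1}"
    unfolding k by auto
  then show ?thesis
    unfolding k by auto
qed

lemma E6_inner_cases:
  assumes "a \<in> E6" "b \<in> E8" "b $ 7 - b $ 8 = 1"
  shows "b \<bullet> a \<in> {-1, 0, 1}"
proof (rule E8_inner_cases)
  have "a $ 7 = a $ 8"
    using assms by (simp add: E6_def)
  then show "b \<noteq> a" "b \<noteq> - a"
    using assms(3) by auto
qed (use assms in \<open>auto simp: E6_def\<close>)

text \<open>With \<open>t\<close> the common value of the last three entries, the roots \<open>e\<^sub>7 \<plusminus> e\<^sub>k\<close> give
\<open>t \<plusminus> y\<^sub>k \<in> {-1, 0, 1}\<close>; the case \<open>k = 6\<close> gives \<open>2 t \<in> {-1, 0, 1}\<close>. If \<open>t = 0\<close>, the vector is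
integral and the norm leaves exactly two entries \<open>\<plusminus>1\<close>. If \<open>t = \<plusminus>1/2\<close>, all entries are
\<open>\<plusminus>1/2\<close>. Should the number of minus signs be odd, changing the sign of one of the
entries 7, 8 gives an admissible root \<open>b\<close> with \<open>b \<cdot> y = 3/2\<close>.\<close>

lemma U_root_test:
  assumes y: "y \<in> U_space" and norm: "y \<bullet> y = 2"
    and test: "\<And>b. b \<in> E8 \<Longrightarrow> b $ 7 - b $ 8 = 1 \<Longrightarrow> b \<bullet> y \<in> {-1, 0, 1}"
  shows "y \<in> E6"
proof -
  define t where "t = y $ 6"
  have t: "y $ 6 = t" "y $ 7 = t" "y $ 8 = t"
    using y by (auto simp: t_def U_space_def)
  have plus: "t + y $ i \<in> {-1, 0, 1}" if "i \<noteq> 7" "i \<noteq> 8" for i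
  proof -
    let ?b = "1 *\<^sub>R axis 7 1 + 1 *\<^sub>R axis i 1 :: real ^ 8"
    have "?b \<in> E8"
      unfolding E8_def using that by blast
    moreover have "?b $ 7 - ?b $ 8 = 1"
      using that by (simp add: axis_def)
    ultimately have "?b \<bullet> y \<in> {-1, 0, 1}"
      by (rule test)
    then show ?thesis
      by (simp add: inner_add_left inner_diff_left inner_axis' t)
  qed
  have minus: "t - y $ i \<in> {-1, 0, 1}" if "i \<noteq> 7" "i \<noteq> 8" for i
  proof -
    let ?b = "1 *\<^sub>R axis 7 1 + (-1) *\<^sub>R axis i 1 :: real ^ 8"
    have "?b \<in> E8"
      unfolding E8_def using that by blast
    moreover have "?b $ 7 - ?b $ 8 = 1"
      using that by (simp add: axis_def)
    ultimately have "?b \<bullet> y \<in> {-1, 0, 1}"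
      by (rule test)
    then show ?thesis
      by (simp add: inner_add_left inner_diff_left inner_axis' t)
  qed
  have "t \<in> {-1/2, 0, 1/2}"
    using plus[of 6] t by auto
  then consider "t = 0" | "t \<in> {1/2, -1/2}"
    by auto
  then have "y \<in> E8"
  proof cases
    case 1
    then have y01: "y $ i \<in> {-1, 0, 1}" for i
      using plus[of i] t by (cases "i = 7 \<or> i = 8") auto
    \<comment> \<open>A square of an entry is one or zero, so the norm counts the nonzero entries.\<close>
    let ?S = "{i. y $ i \<noteq> 0}"
    have "y $ i * y $ i = of_bool (i \<in> ?S)" for i
      using y01[of i] by auto
    then have "real (card ?S) = 2"
      using norm by (simp add: inner_8 of_bool_def sum.If_cases)
    then obtain i j where ij: "?S = {i, j}" "i \<noteq> j"
      by (auto simp: card_2_iff)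
    have "y = y $ i *\<^sub>R axis i 1 + y $ j *\<^sub>R axis j 1"
      using ij by (auto simp: vec_eq_iff axis_def)
    moreover have "y $ i \<in> {1, -1}" "y $ j \<in> {1, -1}"
      using ij y01[of i] y01[of j] by auto
    ultimately show ?thesis
      unfolding E8_def using ij(2) by blast
  next
    case 2
    have half: "y $ i \<in> {1/2, -1/2}" for i
      using plus[of i] minus[of i] t 2 by (cases "i = 7 \<or> i = 8") auto
    have "even (card {i. y $ i = -1/2})"
    proof (rule ccontr)
      assume odd: "odd (card {i. y $ i = -1/2})"
      define b :: "real ^ 8" where "b = (\<chi> i. if i = 7 then 1/2 else if i = 8 then -1/2 else y $ i)"
      let ?S = "{i. y $ i = -1/2}" and ?T = "{i. b $ i = -1/2}"
      have "even (card ?T)"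
      proof (cases "t = 1/2")
        case True
        then have "?T = insert 8 ?S" "8 \<notin> ?S"
          using t by (auto simp: b_def)
        then show ?thesis
          using odd by simp
      next
        case False
        then have "?S = insert 7 ?T" "7 \<notin> ?T"
          using t 2 by (auto simp: b_def)
        then show ?thesis
          using odd by simp
      qed
      moreover have "\<forall>i. b $ i \<in> {1/2, -1/2}"
        using half by (auto simp: b_def)
      ultimately have "b \<in> E8"
        unfolding E8_def by blast
      moreover have "b $ 7 - b $ 8 = 1"
        by (simp add: b_def)
      ultimately have "b \<bullet> y \<in> {-1, 0, 1}"
        by (rule test)
      moreover have "b $ i * y $ i = (if i = 7 then t / 2 else if i = 8 then - t / 2 else 1/4)" for i
        using half_square[OF half[of i]] t by (auto simp: b_def)
      then have "b \<bullet> y = 3/2"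
        by (simp add: inner_8 sum_8)
      ultimately show False
        by simp
    qed
    then show ?thesis
      unfolding E8_def using half by blast
  qed
  then show ?thesis
    using t by (simp add: E6_def)
qed

section \<open>Degrees\<close>

lemma total_degree_le_iff:
  "total_degree p \<le> d \<longleftrightarrow> (\<forall>m\<in>Poly_Mapping.keys p. (\<Sum>i\<in>UNIV. Poly_Mapping.lookup m i) \<le> d)"
  by (auto simp: total_degree_def)

lemma total_degree_add_le: "total_degree p \<le> d \<Longrightarrow> total_degree q \<le> d \<Longrightarrow> total_degree (p + q) \<le> d"
  unfolding total_degree_le_iff using keys_add[of p q] by blast

lemma total_degree_uminus: "total_degree (- p) = total_degree p" for p :: "('n::finite, 'a::ab_group_add) mpoly"
proof -
  have "Poly_Mapping.keys (- p) = Poly_Mapping.keys p"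
    by (auto simp: in_keys_iff)
  then show ?thesis by (simp add: total_degree_def)
qed

lemma total_degree_diff_le: "total_degree p \<le> d \<Longrightarrow> total_degree q \<le> d \<Longrightarrow> total_degree (p - q) \<le> d"
  for p :: "('n::finite, 'a::ab_group_add) mpoly"
  using total_degree_add_le[of p d "- q"] by (simp add: total_degree_uminus)

lemma total_degree_mult_le:
  assumes "total_degree p \<le> d" "total_degree q \<le> e"
  shows "total_degree (p * q) \<le> d + e"
  unfolding total_degree_le_iff
proof
  fix m assume "m \<in> Poly_Mapping.keys (p * q)"
  then obtain a b where "m = a + b" "a \<in> Poly_Mapping.keys p" "b \<in> Poly_Mapping.keys q"
    using keys_mult[of p q] by blast
  then show "(\<Sum>i\<in>UNIV. Poly_Mapping.lookup m i) \<le> d + e"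
    using assms by (auto simp: total_degree_le_iff lookup_add sum.distrib intro: add_mono)
qed

lemma total_degree_Const: "total_degree (Const c) \<le> d"
  by (simp add: total_degree_le_iff Const_def)

lemma total_degree_one: "total_degree (1 :: ('n::finite, 'a::zero_neq_one) mpoly) \<le> d"
  by (simp add: total_degree_le_iff)

lemma total_degree_numeral: "total_degree (numeral n :: ('n::finite, 'a::comm_ring_1) mpoly) \<le> d"
  unfolding Const_numeral[symmetric] by (rule total_degree_Const)

lemma total_degree_Var: "total_degree (Var i :: ('n::finite, 'a::zero_neq_one) mpoly) \<le> 1"
  by (simp add: total_degree_le_iff Var_def lookup_single when_def)

lemma total_degree_sum_le:
  "(\<And>i. i \<in> S \<Longrightarrow> total_degree (f i) \<le> d) \<Longrightarrow> total_degree (sum f S) \<le> d"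
  by (induction S rule: infinite_finite_induct) (auto intro: total_degree_add_le simp: total_degree_le_iff[of 0])

lemma total_degree_dot_poly:
  assumes "\<And>i. total_degree (Y i) \<le> 1"
  shows "total_degree (dot_poly b Y) \<le> 1"
  unfolding dot_poly_def using total_degree_mult_le[OF total_degree_Const[of _ 0] assms]
  by (intro total_degree_sum_le) simp

lemma total_degree_linear_forms: "total_degree (linear_forms L i) \<le> 1"
  unfolding linear_forms_def using total_degree_mult_le[OF total_degree_Const[of _ 0] total_degree_Var]
  by (intro total_degree_sum_le) simp

lemma total_degree_C_poly:
  assumes "\<And>i. total_degree (Y i) \<le> 1"
  shows "total_degree (C_poly b Y) \<le> 3"
proof -
  note d = total_degree_dot_poly[OF assms, of b]
  have "total_degree (C_poly b Y) \<le> (1 + 1) + 1"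
    unfolding C_poly_def
    by (intro total_degree_mult_le total_degree_add_le total_degree_diff_le total_degree_one d)
  then show ?thesis by simp
qed

lemma total_degree_N_poly:
  assumes "\<And>i. total_degree (Y i) \<le> 1"
  shows "total_degree (N_poly Y) \<le> 3"
proof -
  have "total_degree (N_poly Y) \<le> 1 + 1"
    unfolding N_poly_def power2_eq_square
    by (intro total_degree_mult_le total_degree_sum_le total_degree_diff_le total_degree_numeral assms)
  then show ?thesis by simp
qed

section \<open>Polynomials of degree at most two\<close>

lemma exponent_split:
  fixes m :: "'n::finite \<Rightarrow>\<^sub>0 nat"
  assumes "(\<Sum>i\<in>UNIV. Poly_Mapping.lookup m i) = Suc n"
  obtains i m' where "m = Poly_Mapping.single i 1 + m'" "(\<Sum>i\<in>UNIV. Poly_Mapping.lookup m' i) = n"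
proof -
  have "\<exists>i. Poly_Mapping.lookup m i \<noteq> 0"
    using assms by (metis nat.distinct(1) sum.neutral)
  then obtain i where i: "Poly_Mapping.lookup m i \<noteq> 0"
    by blast
  let ?m' = "m - Poly_Mapping.single i 1"
  have m: "m = Poly_Mapping.single i 1 + ?m'"
    using i by (intro poly_mapping_eqI) (auto simp: lookup_add lookup_minus lookup_single when_def)
  have "(\<Sum>i\<in>UNIV. Poly_Mapping.lookup m i) = (\<Sum>j\<in>UNIV. Poly_Mapping.lookup (Poly_Mapping.single i 1) j) + (\<Sum>i\<in>UNIV. Poly_Mapping.lookup ?m' i)"
    unfolding sum.distrib[symmetric] by (rule sum.cong) (metis m lookup_add)+
  moreover have "(\<Sum>j\<in>UNIV. Poly_Mapping.lookup (Poly_Mapping.single i (1::nat)) j) = 1"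
    by (simp add: lookup_single when_def)
  ultimately have "(\<Sum>i\<in>UNIV. Poly_Mapping.lookup ?m' i) = n"
    using assms by simp
  with m show ?thesis
    by (rule that)
qed

lemma exponent_zero: "(\<Sum>i\<in>UNIV. Poly_Mapping.lookup m i) = 0 \<Longrightarrow> m = 0" for m :: "'n::finite \<Rightarrow>\<^sub>0 nat"
  by (intro poly_mapping_eqI) simp

definition quadratic_poly :: "'a \<Rightarrow> ('n \<Rightarrow> 'a) \<Rightarrow> ('n \<Rightarrow> 'n \<Rightarrow> 'a) \<Rightarrow> ('n::finite, 'a::comm_ring_1) mpoly" where
  "quadratic_poly c l B = Const c + (\<Sum>i\<in>UNIV. Const (l i) * Var i) + (\<Sum>i\<in>UNIV. \<Sum>j\<in>UNIV. Const (B i j) * (Var i * Var j))"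

lemma quadratic_poly_add:
  "quadratic_poly c l B + quadratic_poly c' l' B' = quadratic_poly (c + c') (\<lambda>i. l i + l' i) (\<lambda>i j. B i j + B' i j)"
  unfolding quadratic_poly_def Const_simps(3) distrib_right sum.distrib by (simp only: ac_simps)

text \<open>The representable polynomials are closed under addition, so it suffices to represent monomials;
halving a coefficient \<open>a\<close> makes the matrix of \<open>a Y\<^sub>i Y\<^sub>j\<close> symmetric.\<close>

lemma degree_2_normal_form:
  fixes p :: "('n::finite, complex) mpoly"
  assumes "total_degree p \<le> 2"
  obtains c l B where "p = quadratic_poly c l B" "\<And>i j. B i j = B j i"
proof -
  define Q :: "('n, complex) mpoly set" where "Q = {quadratic_poly c l B | c l B. \<forall>i j. B i j = (B j i :: complex)}"
  have QI: "quadratic_poly c l B \<in> Q" if "\<And>i j. B i j = B j i" for c l B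
    unfolding Q_def using that by blast
  have add: "f + g \<in> Q" if f: "f \<in> Q" and g: "g \<in> Q" for f g
  proof -
    obtain c l B where 1: "f = quadratic_poly c l B" "\<And>i j. B i j = B j i"
      using f unfolding Q_def by blast
    obtain c' l' B' where 2: "g = quadratic_poly c' l' B'" "\<And>i j. B' i j = B' j i"
      using g unfolding Q_def by blast
    show ?thesis
      unfolding 1(1) 2(1) quadratic_poly_add by (rule QI) (simp only: 1(2) 2(2))
  qed
  have const: "Const a \<in> Q" for a
    using QI[of "\<lambda>_ _. 0" a "\<lambda>_. 0"] by (simp add: quadratic_poly_def)
  have delta: "(\<Sum>j\<in>UNIV. Const (if j = i then a else 0) * f j) = (Const a * f i :: ('n, complex) mpoly)" for i :: 'n and a f
  proof -
    have "(\<Sum>j\<in>UNIV. Const (if j = i then a else 0) * f j) = (\<Sum>j\<in>UNIV. if j = i then Const a * f j else 0)"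
      by (rule sum.cong) auto
    then show ?thesis
      by simp
  qed
  have linear: "Const a * Var i \<in> Q" for a and i :: 'n
    using QI[of "\<lambda>_ _. 0" 0 "\<lambda>j. if j = i then a else 0"] by (simp add: quadratic_poly_def delta)
  have quad: "Const a * (Var i * Var j) \<in> Q" for a and i j :: 'n
  proof -
    let ?E = "\<lambda>i j k m. if k = i \<and> m = j then a / 2 else 0"
    have E: "(\<Sum>k\<in>UNIV. \<Sum>m\<in>UNIV. Const (?E i j k m) * (Var k * Var m)) = (Const (a / 2) * (Var i * Var j) :: ('n, complex) mpoly)" for i j
    proof -
      have "(\<Sum>m\<in>UNIV. Const (?E i j k m) * (Var k * Var m)) = Const (if k = i then a / 2 else 0) * (Var k * Var j)" for k
        using delta[of j "a / 2" "\<lambda>m. Var k * Var m"] by (cases "k = i") simp_all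
      then show ?thesis
        by (simp only: delta)
    qed
    have half: "Const (a / 2) * 2 = (Const a :: ('n, complex) mpoly)"
      unfolding Const_numeral[symmetric] Const_simps(5)[symmetric] by simp
    have "quadratic_poly 0 (\<lambda>_. 0) (\<lambda>k m. ?E i j k m + ?E j i k m)
        = Const (a / 2) * (Var i * Var j) + Const (a / 2) * (Var j * Var i)"
      unfolding quadratic_poly_def Const_simps(3) distrib_right sum.distrib E by simp
    also have "\<dots> = Const (a / 2) * 2 * (Var i * Var j)"
      unfolding mult.commute[of "Var j" "Var i"] by (simp only: mult_2_right distrib_right)
    finally have "Const a * (Var i * Var j) = quadratic_poly 0 (\<lambda>_. 0) (\<lambda>k m. ?E i j k m + ?E j i k m)"
      by (simp only: half)
    also have "\<dots> \<in> Q"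
      by (rule QI) (simp only: conj_commute add.commute)
    finally show ?thesis .
  qed
  have "Poly_Mapping.single m a \<in> Q" if deg: "(\<Sum>i\<in>UNIV. Poly_Mapping.lookup m i) \<le> 2" for m a
  proof -
    consider "(\<Sum>i\<in>UNIV. Poly_Mapping.lookup m i) = 0" | "(\<Sum>i\<in>UNIV. Poly_Mapping.lookup m i) = Suc 0" | "(\<Sum>i\<in>UNIV. Poly_Mapping.lookup m i) = Suc (Suc 0)"
      using deg by linarith
    then show ?thesis
    proof cases
      case 1
      then show ?thesis
        using const[of a] exponent_zero[of m] by (simp add: Const_def)
    next
      case 2
      then obtain i where "m = Poly_Mapping.single i 1"
        by (auto elim!: exponent_split dest!: exponent_zero)
      then show ?thesis
        using linear[of a i] by (simp add: Const_def Var_def mult_single)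
    next
      case 3
      then obtain i m' where m: "m = Poly_Mapping.single i 1 + m'" "(\<Sum>i\<in>UNIV. Poly_Mapping.lookup m' i) = Suc 0"
        by (rule exponent_split)
      from m(2) obtain j where "m' = Poly_Mapping.single j 1"
        by (auto elim!: exponent_split dest!: exponent_zero)
      with m(1) have "m = Poly_Mapping.single i 1 + Poly_Mapping.single j 1"
        by simp
      then show ?thesis
        using quad[of a i j] by (simp add: Const_def Var_def mult_single)
    qed
  qed
  then have partial: "(\<Sum>m\<in>S. Poly_Mapping.single m (Poly_Mapping.lookup p m)) \<in> Q" if "S \<subseteq> Poly_Mapping.keys p" for S
    using that finite_subset[OF that] assms unfolding total_degree_le_iff
    by (induction S rule: infinite_finite_induct) (use const[of 0] add in auto)
  have "p \<in> Q"
    by (subst mpoly_sum_singles) (rule partial[OF subset_refl])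
  then show ?thesis
    using that unfolding Q_def by blast
qed

lemma sum_axis: "(\<Sum>k\<in>UNIV. axis i 1 $ k *\<^sub>R f k) = f i" for f :: "'n::finite \<Rightarrow> 'b::real_vector"
  by (simp add: axis_def if_distrib if_distribR cong: if_cong)

section \<open>The ideal generated by the norm and the cubics\<close>

locale E6_embedding =
  fixes L :: "real ^ 6 \<Rightarrow> real ^ 8"
  assumes lin: "linear L" and bij: "bij_betw L UNIV U_space" and norm_L: "norm (L x) = sqrt 2 * norm x"
begin

abbreviation "Y \<equiv> linear_forms L"
abbreviation "J \<equiv> ideal_J L"

lemma L_in_U: "L x \<in> U_space"
  using bij by (auto simp: bij_betw_def)

text \<open>Polarization turns the norm hypothesis into a statement about inner products, so that
\<open>L\<close> has half its transpose as a left inverse.\<close>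

lemma inner_L: "L x \<bullet> L y = 2 * (x \<bullet> y)"
proof -
  have sq: "(norm (L v))\<^sup>2 = 2 * (norm v)\<^sup>2" for v
    by (simp add: norm_L power_mult_distrib)
  show ?thesis
    unfolding dot_norm linear_add[OF lin, symmetric] sq by (simp add: field_simps)
qed

lemma L_nth: "L x $ i = (\<Sum>j\<in>UNIV. x $ j * L (axis j 1) $ i)"
proof -
  have "x = (\<Sum>j\<in>UNIV. x $ j *\<^sub>R axis j 1)"
    using basis_expansion[of x] by (simp add: scalar_mult_eq_scaleR)
  then have "L x = (\<Sum>j\<in>UNIV. x $ j *\<^sub>R L (axis j 1))"
    by (metis (no_types, lifting) linear_sum[OF lin] linear_scale[OF lin] sum.cong)
  then show ?thesis
    by simp
qed

lemma eval_linear_forms: "poly_eval (Y i) x = L x $ i"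
  by (simp add: linear_forms_def L_nth[of x] mult.commute)

lemma eval_dot_poly: "poly_eval (dot_poly b Y) x = b \<bullet> L x"
  by (simp add: dot_poly_def eval_linear_forms inner_8)

lemma eval_C_poly: "poly_eval (C_poly b Y) x = 0 \<longleftrightarrow> b \<bullet> L x \<in> {-1, 0, 1}"
  by (auto simp: C_poly_def eval_dot_poly eq_neg_iff_add_eq_0)

lemma eval_N_poly: "poly_eval (N_poly Y) x = L x \<bullet> L x - 2"
  by (simp add: N_poly_def eval_linear_forms inner_8 power2_eq_square)

lemma is_ideal_J: "is_ideal J"
  by (simp add: ideal_J_def is_ideal_ideal_gen)

lemma N_in_J: "N_poly Y \<in> J"
  unfolding ideal_J_def by (intro ideal_gen_superset) simp

lemma C_in_J: "b \<in> E8 \<Longrightarrow> b $ 7 - b $ 8 = 1 \<Longrightarrow> C_poly b Y \<in> J"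
  unfolding ideal_J_def by (intro ideal_gen_superset) blast

lemma J_minimal:
  assumes "is_ideal I" "N_poly Y \<in> I" "\<And>b. b \<in> E8 \<Longrightarrow> b $ 7 - b $ 8 = 1 \<Longrightarrow> C_poly b Y \<in> I"
  shows "J \<subseteq> I"
  unfolding ideal_J_def by (rule ideal_gen_minimal) (use assms in auto)

text \<open>Both directions are the finite computations of the section on roots, read through the evaluation
of the generators.\<close>

lemma real_zeros_J: "(\<forall>f\<in>J. poly_eval f x = 0) \<longleftrightarrow> L x \<in> E6"
proof
  assume "\<forall>f\<in>J. poly_eval f x = 0"
  then have "poly_eval (N_poly Y) x = 0" "\<And>b. b \<in> E8 \<Longrightarrow> b $ 7 - b $ 8 = 1 \<Longrightarrow> poly_eval (C_poly b Y) x = 0"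
    using N_in_J C_in_J by blast+
  then show "L x \<in> E6"
    by (intro U_root_test L_in_U) (simp_all only: eval_N_poly eval_C_poly right_minus_eq)
next
  assume root: "L x \<in> E6"
  have "J \<subseteq> {f. poly_eval f x = 0}"
  proof (rule J_minimal)
    show "N_poly Y \<in> {f. poly_eval f x = 0}"
      using root E8_norm by (simp add: eval_N_poly E6_def)
    show "C_poly b Y \<in> {f. poly_eval f x = 0}" if "b \<in> E8" "b $ 7 - b $ 8 = 1" for b
      using E6_inner_cases[OF root that] by (simp only: mem_Collect_eq eval_C_poly)
  qed (intro is_ideal_kernel poly_eval_simps)
  then show "\<forall>f\<in>J. poly_eval f x = 0"
    by blast
qed

text \<open>These roots are admissible for \<open>k \<le> 6\<close>. On \<open>U\<close> they have the values \<open>y\<^sub>6 + y\<^sub>k\<close>, which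
determine \<open>2 y\<^sub>6\<close> (for \<open>k = 6\<close>) and then every \<open>y\<^sub>k\<close>.\<close>

definition probe :: "8 \<Rightarrow> real ^ 8" where "probe k = 1 *\<^sub>R axis 7 1 + 1 *\<^sub>R axis k 1"
definition probes :: "(6, real) mpoly set" where "probes = (\<lambda>k. dot_poly (probe k) Y) ` {k. k \<noteq> 7 \<and> k \<noteq> 8}"

lemma probe_root:
  assumes "k \<noteq> 7" "k \<noteq> 8"
  shows "probe k \<in> E8" "probe k $ 7 - probe k $ 8 = 1"
proof -
  show "probe k \<in> E8"
    unfolding E8_def probe_def using assms by blast
  show "probe k $ 7 - probe k $ 8 = 1"
    using assms by (simp add: probe_def axis_def)
qed

lemma Y_U: "Y 7 = Y 6" "Y 8 = Y 6"
proof -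
  have "L v $ 7 = L v $ 6" "L v $ 8 = L v $ 6" for v
    using L_in_U[of v] by (auto simp: U_space_def)
  then show "Y 7 = Y 6" "Y 8 = Y 6"
    by (simp_all add: linear_forms_def)
qed

lemma dot_probe: "k \<noteq> 7 \<Longrightarrow> dot_poly (probe k) Y = Y 6 + Y k"
proof -
  assume "k \<noteq> 7"
  then have "dot_poly (probe k) Y = (\<Sum>i\<in>UNIV. (if i = 7 then Y i else 0) + (if i = k then Y i else 0))"
    unfolding dot_poly_def by (intro sum.cong) (auto simp: probe_def axis_def)
  then show ?thesis
    by (simp add: sum.distrib Y_U)
qed

text \<open>The probes span the polynomials \<open>Y k\<close>, and the left inverse of \<open>L\<close> expresses the variables
through these: \<open>x\<^sub>j = 1/2 (L x \<cdot> L e\<^sub>j)\<close>.\<close>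

lemma Var_in_span: "Var j \<in> module.span scale probes"
proof -
  note span = module.span_base[OF coeff_module] module.span_scale[OF coeff_module] module.span_sum[OF coeff_module] module.span_diff[OF coeff_module]
  have base: "Y 6 + Y k \<in> module.span scale probes" if "k \<noteq> 7" "k \<noteq> 8" for k
    using that dot_probe[of k] by (intro span(1)) (auto simp: probes_def image_iff)
  have "Const (1/2) * 2 = (1 :: (6, real) mpoly)"
    unfolding Const_numeral[symmetric] Const_simps(5)[symmetric] by simp
  then have Y6_eq: "Const (1/2) * (Y 6 + Y 6) = Y 6"
    by (simp only: mult_2[symmetric] mult.assoc[symmetric] mult_1)
  have Y6: "Y 6 \<in> module.span scale probes"
    using span(2)[OF base[of 6], of "1/2"] unfolding Y6_eq by simp
  have Yk: "Y k \<in> module.span scale probes" for k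
  proof (cases "k = 7 \<or> k = 8")
    case True
    then show ?thesis using Y6 Y_U by auto
  next
    case False
    then show ?thesis
      using span(4)[OF base[of k] Y6] by simp
  qed
  have inner: "(\<Sum>k\<in>UNIV. L (axis j 1) $ k * L (axis m 1) $ k) = (if m = j then 2 else 0)" for m
    using inner_L[of "axis j 1" "axis m 1"] by (simp add: inner_8 inner_axis_axis)
  have "(\<Sum>k\<in>UNIV. Const (L (axis j 1) $ k) * Y k)
      = (\<Sum>m\<in>UNIV. Const (\<Sum>k\<in>UNIV. L (axis j 1) $ k * L (axis m 1) $ k) * Var m)"
    unfolding linear_forms_def sum_distrib_left Const_sum sum_distrib_right
    by (subst sum.swap) (simp add: mult.assoc)
  also have "\<dots> = Const 2 * Var j"
    by (simp add: inner if_distrib if_distribR cong: if_cong)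
  finally have "Const (1/2) * (\<Sum>k\<in>UNIV. Const (L (axis j 1) $ k) * Y k) = Var j"
    by (simp add: mult.assoc[symmetric] flip: Const_simps(5))
  moreover have "Const (1/2) * (\<Sum>k\<in>UNIV. Const (L (axis j 1) $ k) * Y k) \<in> module.span scale probes"
    by (intro span Yk)
  ultimately show ?thesis
    by simp
qed

lemma split_probe: "(\<Prod>a\<in>{-1, 0, 1}. F - Const a) = (F - 1) * F * (F + 1)" for F :: "('n, 'a::{comm_ring_1,ring_char_0}) mpoly"
  by (simp add: algebra_simps)

lemma probes_split: "F \<in> probes \<Longrightarrow> (\<Prod>a\<in>{-1, 0, 1}. F - Const a) \<in> J"
  unfolding split_probe using C_in_J[OF probe_root] by (auto simp: probes_def C_poly_def)

lemma finite_probes: "finite probes"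
  by (simp add: probes_def)

text \<open>A power of \<open>p\<close> vanishes where \<open>p\<close> does, and membership in \<open>J\<close> depends only on the
vanishing at the real zeros of \<open>J\<close>.\<close>

theorem J_radical: "radical_ideal J"
  unfolding radical_ideal_def
proof (intro conjI allI impI is_ideal_J)
  fix p n assume "p ^ n \<in> J"
  then have van: "poly_eval p x = 0" if "\<And>f. f \<in> J \<Longrightarrow> poly_eval f x = 0" for x
    using that[of "p ^ n"] by simp
  show "p \<in> J"
    by (rule vanishing_imp_in_ideal[OF is_ideal_J _ _ finite_probes probes_split Var_in_span van]) auto
qed

text \<open>The polynomials that take real values at a common zero \<open>z\<close> form a real vector space. It contains
the probes, whose values are \<open>-1, 0, 1\<close>, and therefore the coordinates of \<open>z\<close>.\<close>

theorem zeros_J: "zero_set (complex_mpoly ` J) = E6_points L"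
proof
  show "E6_points L \<subseteq> zero_set (complex_mpoly ` J)"
  proof
    fix z assume "z \<in> E6_points L"
    then obtain x where "z = complex_vec x" "L x \<in> E6"
      by (auto simp: E6_points_def)
    then show "z \<in> zero_set (complex_mpoly ` J)"
      using real_zeros_J[of x] by (simp add: zero_set_def poly_eval_complex_vec)
  qed
  show "zero_set (complex_mpoly ` J) \<subseteq> E6_points L"
  proof
    fix z assume "z \<in> zero_set (complex_mpoly ` J)"
    then have z: "poly_eval (complex_mpoly f) z = 0" if "f \<in> J" for f
      using that by (auto simp: zero_set_def)
    let ?R = "{f. poly_eval (complex_mpoly f) z \<in> \<real>}"
    have "module.subspace scale ?R"
      by (rule module.subspaceI[OF coeff_module]) auto
    moreover have "probes \<subseteq> ?R"
    proof
      fix F assume "F \<in> probes"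
      from z[OF probes_split[OF this]] show "F \<in> ?R"
        by (auto simp: split_probe eq_neg_iff_add_eq_0[symmetric])
    qed
    ultimately have "module.span scale probes \<subseteq> ?R"
      by (intro module.span_minimal[OF coeff_module])
    then have "z $ j \<in> \<real>" for j
      using Var_in_span[of j] by auto
    then have "z = complex_vec (\<chi> j. Re (z $ j))"
      by (simp add: complex_vec_def vec_eq_iff)
    then obtain x where x: "z = complex_vec x"
      by blast
    then have "L x \<in> E6"
      using z real_zeros_J[of x] by (simp add: poly_eval_complex_vec)
    then show "z \<in> E6_points L"
      using x by (simp add: E6_points_def)
  qed
qed

text \<open>The cubic generators of \<open>J\<close> have degree at most three and vanish on the roots, so the ideal
generated by all such polynomials has no zeros besides the roots, and it contains a split cubic for
each of the probes.\<close>

theorem cubic_generators: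
  "ideal_gen {p \<in> vanishing_ideal (E6_points L). total_degree p \<le> 3} = vanishing_ideal (E6_points L)"
    (is "ideal_gen ?G = ?I")
proof
  show "ideal_gen ?G \<subseteq> ?I"
    by (rule ideal_gen_minimal) (auto intro: is_ideal_vanishing_ideal)
  have J_I: "complex_mpoly f \<in> ?I" if "f \<in> J" for f
    using that unfolding zeros_J[symmetric] by (auto simp: vanishing_ideal_def zero_set_def)
  have N: "complex_mpoly (N_poly Y) \<in> ideal_gen ?G"
    using J_I[OF N_in_J] total_degree_N_poly[OF total_degree_linear_forms]
    by (intro ideal_gen_superset) (simp add: total_degree_complex_mpoly)
  have C: "complex_mpoly (C_poly b Y) \<in> ideal_gen ?G" if "b \<in> E8" "b $ 7 - b $ 8 = 1" for b
    using J_I[OF C_in_J[OF that]] total_degree_C_poly[OF total_degree_linear_forms]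
    by (intro ideal_gen_superset) (simp add: total_degree_complex_mpoly)
  have zeros: "x \<in> E6_points L" if "\<And>f. f \<in> ideal_gen ?G \<Longrightarrow> poly_eval f x = 0" for x
  proof -
    have "J \<subseteq> {f. poly_eval (complex_mpoly f) x = 0}"
      using that N C by (intro J_minimal is_ideal_kernel) auto
    then show ?thesis
      unfolding zeros_J[symmetric] by (auto simp: zero_set_def)
  qed
  show "?I \<subseteq> ideal_gen ?G"
  proof
    fix p assume p: "p \<in> ?I"
    show "p \<in> ideal_gen ?G"
    proof (rule vanishing_imp_in_ideal[where A = "{-1, 0, 1}" and Fs = "complex_mpoly ` probes"])
      fix F assume "F \<in> complex_mpoly ` probes"
      then obtain k where k: "k \<noteq> 7" "k \<noteq> 8" "F = complex_mpoly (dot_poly (probe k) Y)"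
        by (auto simp: probes_def)
      then have "(\<Prod>a\<in>{-1, 0, 1}. F - Const a) = complex_mpoly (C_poly (probe k) Y)"
        by (simp add: split_probe C_poly_def)
      then show "(\<Prod>a\<in>{-1, 0, 1}. F - Const a) \<in> ideal_gen ?G"
        using C[OF probe_root[OF k(1,2)]] by simp
    next
      show "Var i \<in> module.span scale (complex_mpoly ` probes)" for i
        using complex_mpoly_span[OF Var_in_span[of i]] by simp
    next
      show "poly_eval p x = 0" if "\<And>f. f \<in> ideal_gen ?G \<Longrightarrow> poly_eval f x = 0" for x
        using p zeros[OF that] by (simp add: vanishing_ideal_def)
    qed (auto simp: is_ideal_ideal_gen finite_probes)
  qed
qed

section \<open>Quadratic polynomials vanishing on the roots\<close>

text \<open>The root test is symmetric under \<open>y \<mapsto> -y\<close>.\<close>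

lemma E6_uminus: "L x \<in> E6 \<Longrightarrow> L (- x) \<in> E6"
proof -
  assume root: "L x \<in> E6"
  show "L (- x) \<in> E6"
  proof (rule U_root_test[OF L_in_U])
    show "L (- x) \<bullet> L (- x) = 2"
      using E8_norm[of "L x"] root by (simp add: inner_L E6_def)
    show "b \<bullet> L (- x) \<in> {-1, 0, 1}" if "b \<in> E8" "b $ 7 - b $ 8 = 1" for b
      using E6_inner_cases[OF root that] by (auto simp: linear_neg[OF lin])
  qed
qed

text \<open>The coordinates of \<open>U\<close> that are not tied to others.\<close>

definition K :: "8 set" where "K = {1, 2, 3, 4, 5}"

definition pre :: "real ^ 8 \<Rightarrow> real ^ 6" where "pre = inv_into UNIV L"

lemma L_pre: "y \<in> U_space \<Longrightarrow> L (pre y) = y"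
  using bij unfolding pre_def by (simp add: bij_betw_def f_inv_into_f)

lemma L_inj: "L x = L y \<Longrightarrow> x = y"
  using bij by (auto simp: bij_betw_def inj_on_def)

abbreviation half :: "real ^ 8" where "half \<equiv> \<chi> i. 1/2"
text \<open>The vectors \<open>u k\<close> for \<open>k \<in> K\<close> and the root \<open>w\<close> form a basis of \<open>\<real>\<^sup>6\<close>. Taking the root \<open>w\<close>
instead of the preimage of \<open>e\<^sub>6 + e\<^sub>7 + e\<^sub>8\<close> makes \<open>w - (u i + u j)\<close> a root as well, which
is the only further kind of root that the polarization argument uses.\<close>

definition u :: "8 \<Rightarrow> real ^ 6" where "u k = pre (axis k 1)"
definition w :: "real ^ 6" where "w = pre half"

lemma L_u: "k \<in> K \<Longrightarrow> L (u k) = axis k 1"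
  unfolding u_def by (rule L_pre) (auto simp: K_def U_space_def axis_def)

lemma L_w: "L w = half"
  unfolding w_def by (rule L_pre) (auto simp: U_space_def)

lemma K_not: "i \<in> K \<Longrightarrow> i \<noteq> 6 \<and> i \<noteq> 7 \<and> i \<noteq> 8"
  by (auto simp: K_def)

lemma roots:
  shows "i \<in> K \<Longrightarrow> j \<in> K \<Longrightarrow> i \<noteq> j \<Longrightarrow> L (u i + u j) \<in> E6"
    and "i \<in> K \<Longrightarrow> j \<in> K \<Longrightarrow> i \<noteq> j \<Longrightarrow> L (u i - u j) \<in> E6"
    and "L w \<in> E6"
    and "i \<in> K \<Longrightarrow> j \<in> K \<Longrightarrow> i \<noteq> j \<Longrightarrow> L (w - (u i + u j)) \<in> E6"
proof -
  have E6I: "a \<in> E6" if "a \<in> E8" "a \<in> U_space" for a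
    using that by (auto simp: E6_def U_space_def)
  show "L (u i + u j) \<in> E6" if "i \<in> K" "j \<in> K" "i \<noteq> j"
  proof (rule E6I[OF _ L_in_U])
    have "L (u i + u j) = 1 *\<^sub>R axis i 1 + 1 *\<^sub>R axis j 1"
      using that by (simp add: linear_add[OF lin] L_u)
    then show "L (u i + u j) \<in> E8"
      unfolding E8_def using that(3) by blast
  qed
  show "L (u i - u j) \<in> E6" if "i \<in> K" "j \<in> K" "i \<noteq> j"
  proof (rule E6I[OF _ L_in_U])
    have "L (u i - u j) = 1 *\<^sub>R axis i 1 + (-1) *\<^sub>R axis j 1"
      using that by (simp add: linear_diff[OF lin] L_u)
    then show "L (u i - u j) \<in> E8"
      unfolding E8_def using that(3) by blast
  qed
  show "L w \<in> E6"
  proof (rule E6I[OF _ L_in_U])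
    show "L w \<in> E8"
      unfolding L_w E8_def by simp
  qed
  show "L (w - (u i + u j)) \<in> E6" if "i \<in> K" "j \<in> K" "i \<noteq> j"
  proof (rule E6I[OF _ L_in_U])
    let ?v = "L (w - (u i + u j))"
    have v: "?v $ k = (if k = i \<or> k = j then - 1/2 else 1/2)" for k
      using that by (auto simp: linear_add[OF lin] linear_diff[OF lin] L_u L_w axis_def)
    then have "{k. ?v $ k = - 1/2} = {i, j}"
      by auto
    then have "even (card {k. ?v $ k = - 1/2})"
      using that(3) by (simp only:) simp
    moreover have "?v $ k \<in> {1/2, -1/2}" for k
      by (simp add: v)
    ultimately show "?v \<in> E8"
      unfolding E8_def by blast
  qed
qed

lemma basis_expansion_u: "x = (\<Sum>k\<in>K. (L x $ k - L x $ 6) *\<^sub>R u k) + (2 * L x $ 6) *\<^sub>R w"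
proof (rule L_inj)
  have "L ((\<Sum>k\<in>K. (L x $ k - L x $ 6) *\<^sub>R u k) + (2 * L x $ 6) *\<^sub>R w)
      = (\<Sum>k\<in>K. (L x $ k - L x $ 6) *\<^sub>R axis k 1) + (2 * L x $ 6) *\<^sub>R half"
    by (simp add: linear_add[OF lin] linear_sum[OF lin] linear_scale[OF lin] L_u L_w)
  also have "\<dots> = L x"
  proof (subst vec_eq_iff, rule allI)
    fix i :: 8
    have "i \<in> K \<or> i = 6 \<or> i = 7 \<or> i = 8"
      using UNIV_8 by (auto simp: K_def)
    moreover have "(\<Sum>k\<in>K. (L x $ k - L x $ 6) * (axis k 1 $ i)) = (if i \<in> K then L x $ i - L x $ 6 else 0)"
      by (simp add: axis_def if_distrib cong: if_cong)
    ultimately show "((\<Sum>k\<in>K. (L x $ k - L x $ 6) *\<^sub>R axis k 1) + (2 * L x $ 6) *\<^sub>R half) $ i = L x $ i"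
      using L_in_U[of x] K_not[of i] by (auto simp: U_space_def)
  qed
  finally show "L x = L ((\<Sum>k\<in>K. (L x $ k - L x $ 6) *\<^sub>R u k) + (2 * L x $ 6) *\<^sub>R w)" ..
qed

lemma linear_zero:
  fixes f :: "real ^ 6 \<Rightarrow> complex"
  assumes "linear f" "\<And>k. k \<in> K \<Longrightarrow> f (u k) = 0" "f w = 0"
  shows "f x = 0"
proof -
  have "f ((\<Sum>k\<in>K. (L x $ k - L x $ 6) *\<^sub>R u k) + (2 * L x $ 6) *\<^sub>R w) = 0"
    by (simp add: linear_add[OF assms(1)] linear_sum[OF assms(1)] linear_scale[OF assms(1)] assms(2,3))
  then show ?thesis
    using basis_expansion_u[of x] by simp
qed

lemma K_third: "\<exists>k\<in>K. k \<noteq> i \<and> k \<noteq> j"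
proof -
  have "card {i, j} < card K"
    by (rule le_less_trans[OF card_insert_le_m1[of 2]]) (simp_all add: K_def)
  then have "\<not> K \<subseteq> {i, j}"
    using card_mono[of "{i, j}" K] by auto
  then show ?thesis
    by auto
qed

text \<open>Three indices suffice: \<open>2 f(i) = (f(i) + f(j)) + (f(i) + f(k)) - (f(j) + f(k))\<close>.\<close>

lemma pairwise_cancel:
  fixes f :: "8 \<Rightarrow> complex"
  assumes "\<And>i j. i \<in> K \<Longrightarrow> j \<in> K \<Longrightarrow> i \<noteq> j \<Longrightarrow> f i + f j = 0" and "i \<in> K"
  shows "f i = 0"
proof -
  obtain j where j: "j \<in> K" "j \<noteq> i"
    using K_third[of i i] by auto
  obtain k where k: "k \<in> K" "k \<noteq> i" "k \<noteq> j"
    using K_third[of i j] by auto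
  have "f i + f j = 0" "f i + f k = 0" "f j + f k = 0"
    using assms(2) j k by (simp_all add: assms(1))
  then have "2 * f i = 0"
    by algebra
  then show ?thesis
    by simp
qed

text \<open>The form is computed on the basis. Comparing the roots \<open>u i + u j\<close> and \<open>u i - u j\<close> gives
\<open>g (u i) (u j) = 0\<close> and \<open>g (u i) (u i) = - g (u j) (u j)\<close>, hence all \<open>g (u i) (u i) = 0\<close>.
Expanding \<open>g a a = 0\<close> for the root \<open>a = w - (u i + u j)\<close> then leaves
\<open>g w (u i) + g w (u j) = 0\<close>.\<close>

lemma symmetric_form_zero:
  fixes g :: "real ^ 6 \<Rightarrow> real ^ 6 \<Rightarrow> complex"
  assumes g: "\<And>x. linear (g x)" and sym: "\<And>x y. g x y = g y x" and roots0: "\<And>a. L a \<in> E6 \<Longrightarrow> g a a = 0"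
  shows "g x y = 0"
proof -
  have addR: "g x (y + z) = g x y + g x z" and diffR: "g x (y - z) = g x y - g x z" for x y z
    by (rule linear_add[OF g] linear_diff[OF g])+
  have addL: "g (y + z) x = g y x + g z x" and diffL: "g (y - z) x = g y x - g z x" for x y z
    unfolding sym[of _ x] by (rule addR diffR)+
  note add = addR diffR addL diffL
  have uu: "g (u i) (u j) = 0 \<and> g (u i) (u i) + g (u j) (u j) = 0" if "i \<in> K" "j \<in> K" "i \<noteq> j" for i j
  proof -
    have "g (u i + u j) (u i + u j) = 0" "g (u i - u j) (u i - u j) = 0"
      using roots0 roots(1,2) that by blast+
    then have plus: "g (u i) (u i) + 2 * g (u i) (u j) + g (u j) (u j) = 0"
      and minus: "g (u i) (u i) - 2 * g (u i) (u j) + g (u j) (u j) = 0"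
      using sym[of "u j" "u i"] by (simp_all add: add algebra_simps)
    have "4 * g (u i) (u j) = 0"
      using plus minus by algebra
    then show ?thesis
      using plus by simp
  qed
  have diag: "g (u i) (u i) = 0" if "i \<in> K" for i
    using pairwise_cancel[of "\<lambda>i. g (u i) (u i)"] uu that by blast
  have ww: "g w w = 0"
    using roots0 roots(3) by blast
  have "g w (u i) + g w (u j) = 0" if "i \<in> K" "j \<in> K" "i \<noteq> j" for i j
  proof -
    have "g (w - (u i + u j)) (w - (u i + u j)) = 0"
      using roots0 roots(4) that by blast
    then have "- g w (u i) = g w (u j)"
      using uu[OF that] diag[OF that(1)] diag[OF that(2)] ww sym[of "u j" "u i"] sym[of "u i" w] sym[of "u j" w]
      by (simp add: add)
    then show ?thesis
      by (metis add.right_inverse)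
  qed
  then have wu: "g w (u i) = 0" if "i \<in> K" for i
    using pairwise_cancel[of "\<lambda>i. g w (u i)"] that by blast
  have gu: "g (u i) y = 0" if i: "i \<in> K" for i y
  proof (rule linear_zero[OF g])
    show "g (u i) (u k) = 0" if "k \<in> K" for k
      using uu[OF i that] diag[OF i] by (cases "i = k") auto
    show "g (u i) w = 0"
      using wu[OF i] sym[of w] by simp
  qed
  have gw: "g w y = 0" for y
    by (rule linear_zero[OF g wu ww])
  show ?thesis
  proof (rule linear_zero[OF g])
    show "g x (u k) = 0" if "k \<in> K" for k
      unfolding sym[of x "u k"] by (rule gu[OF that])
    show "g x w = 0"
      unfolding sym[of x w] by (rule gw)
  qed
qed

text \<open>Roots have norm one in \<open>\<real>\<^sup>6\<close>, so \<open>bet a a = - c\<close> on the roots says that the form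
\<open>bet + c\<close> times the inner product vanishes on them; its being zero means that the quadratic part
of \<open>p\<close> is \<open>- c \<Sum> Y\<^sub>i\<^sup>2\<close>.\<close>

theorem degree_2_trivial:
  assumes p: "p \<in> vanishing_ideal (E6_points L)" and "total_degree p \<le> 2"
  shows "trivial_poly p"
proof -
  obtain c l B where pq: "p = quadratic_poly c l B" and B: "\<And>i j. B i j = B j i"
    using degree_2_normal_form[OF assms(2)] by blast
  define lam where "lam v = (\<Sum>i\<in>UNIV. v $ i *\<^sub>R l i)" for v :: "real ^ 6"
  define bet where "bet v v' = (\<Sum>i\<in>UNIV. v $ i *\<^sub>R (\<Sum>j\<in>UNIV. v' $ j *\<^sub>R B i j))" for v v' :: "real ^ 6"
  have lam: "linear lam"
    by (rule linearI) (simp_all add: lam_def scaleR_add_left sum.distrib scaleR_sum_right)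
  have bet: "linear (bet v)" for v
    by (rule linearI) (simp_all add: bet_def scaleR_add_left scaleR_add_right sum.distrib scaleR_sum_right mult.left_commute)
  have bet_sym: "bet v v' = bet v' v" for v v'
    unfolding bet_def scaleR_sum_right
    by (subst sum.swap) (simp only: B scaleR_left_commute)
  have eval: "c + lam v + bet v v = 0" if "L v \<in> E6" for v
  proof -
    have "poly_eval p (complex_vec v) = 0"
      using p that by (auto simp: vanishing_ideal_def E6_points_def)
    then show ?thesis
      by (simp add: pq quadratic_poly_def lam_def bet_def complex_vec_def scaleR_conv_of_real sum_distrib_left mult.commute mult.left_commute)
  qed
  have root: "lam v = 0 \<and> bet v v = - c" if "L v \<in> E6" for v
  proof -
    have "c + lam v + bet v v = 0" "c - lam v + bet v v = 0"
      using eval[OF that] eval[OF E6_uminus[OF that]] bet_sym[of "- v" v]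
      by (simp_all add: linear_neg[OF lam] linear_neg[OF bet])
    moreover from this have "2 * lam v = 0"
      by algebra
    ultimately show ?thesis
      by (simp add: eq_neg_iff_add_eq_0 add.commute)
  qed
  have "lam (u i) + lam (u j) = 0" if "i \<in> K" "j \<in> K" "i \<noteq> j" for i j
    using root[OF roots(1)[OF that]] by (simp add: linear_add[OF lam])
  then have "lam v = 0" for v
    using linear_zero[OF lam] root[OF roots(3)] pairwise_cancel[of "\<lambda>i. lam (u i)"] by blast
  then have "lam (axis i 1) = 0" for i
    by blast
  then have l: "l i = 0" for i
    by (simp add: lam_def sum_axis)
  define g where "g v v' = bet v v' + c * of_real (v \<bullet> v')" for v v'
  have "g v v' = 0" for v v'
  proof (rule symmetric_form_zero)
    have scale: "c * of_real (r * s) = r *\<^sub>R (c * of_real s)" for r s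
      by (simp add: scaleR_conv_of_real)
    show "linear (g x)" for x
      by (rule linearI)
         (simp_all add: g_def linear_add[OF bet] linear_scale[OF bet] inner_add_right distrib_left
           scale scaleR_add_right del: of_real_mult)
    show "g x y = g y x" for x y
      by (simp add: g_def bet_sym inner_commute)
    show "g a a = 0" if "L a \<in> E6" for a
    proof -
      have "a \<bullet> a = 1"
        using inner_L[of a a] E8_norm[of "L a"] that by (simp add: E6_def)
      then show ?thesis
        using root[OF that] by (simp add: g_def)
    qed
  qed
  then have "g (axis i 1) (axis j 1) = 0" for i j
    by blast
  moreover have "complex_of_real ((axis i 1 :: real ^ 6) \<bullet> axis j 1) = (if i = j then 1 else 0)" for i j
    by (simp add: inner_axis_axis)
  ultimately have entry: "B i j + c * (if i = j then 1 else 0) = 0" for i j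
    by (simp only: g_def bet_def sum_axis)
  have B_eq: "B i j = (if j = i then - c else 0)" for i j
    using entry[of i j] by (cases "i = j") (auto simp: eq_neg_iff_add_eq_0)
  have "Const (B i j) * (Var i * Var j) = (if j = i then - (Const c * (Var i)\<^sup>2) else 0)" for i j
    by (simp add: B_eq power2_eq_square)
  then have "p = Const c - Const c * (\<Sum>i\<in>UNIV. (Var i)\<^sup>2)"
    by (simp add: pq quadratic_poly_def l sum_negf sum_distrib_left)
  then have "p = ((\<Sum>i\<in>UNIV. (Var i)\<^sup>2) - 1) * (- Const c)"
    by (simp add: algebra_simps)
  then show ?thesis
    unfolding trivial_poly_def by (rule dvdI)
qed

text \<open>By \<open>degree_2_trivial\<close> the degree of a nontrivial cubic cannot drop, so only nontriviality has to
be checked: the cubic for \<open>b = e\<^sub>7 + e\<^sub>1\<close> is nonzero at the unit vector \<open>x\<close> with \<open>b \<cdot> L x = \<surd>2\<close>.\<close>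

theorem nontrivial_cubic: "\<exists>p\<in>vanishing_ideal (E6_points L). \<not> trivial_poly p \<and> total_degree p = 3"
proof -
  let ?f = "C_poly (probe 1) Y"
  let ?p = "complex_mpoly ?f"
  have I: "?p \<in> vanishing_ideal (E6_points L)"
    using C_in_J[OF probe_root[of 1]] unfolding zeros_J[symmetric] by (auto simp: vanishing_ideal_def zero_set_def)
  define x where "x = sqrt 2 *\<^sub>R u 1"
  have L_u1: "L (u 1) = axis 1 1"
    by (rule L_u) (simp add: K_def)
  have "probe 1 \<bullet> L x = sqrt 2"
    by (simp add: x_def linear_scale[OF lin] L_u1 probe_def inner_add_left inner_axis_axis)
  moreover have "1 < sqrt (2 :: real)"
    by simp
  then have "sqrt 2 \<noteq> (-1 :: real)" "sqrt 2 \<noteq> (0 :: real)" "sqrt 2 \<noteq> (1 :: real)"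
    by linarith+
  ultimately have nz: "poly_eval ?p (complex_vec x) \<noteq> 0"
    unfolding poly_eval_complex_vec of_real_eq_0_iff eval_C_poly by simp
  have "\<not> trivial_poly ?p"
  proof
    assume "trivial_poly ?p"
    then obtain q where "?p = ((\<Sum>i\<in>UNIV. (Var i)\<^sup>2) - 1) * q"
      unfolding trivial_poly_def by (elim dvdE)
    moreover have "(\<Sum>i\<in>UNIV. (complex_of_real (x $ i))\<^sup>2) = of_real (x \<bullet> x)"
      by (simp add: inner_vec_def power2_eq_square)
    moreover have "x \<bullet> x = 1"
      using inner_L[of "u 1" "u 1"] by (simp add: x_def L_u1 inner_axis_axis flip: mult.assoc)
    ultimately show False
      using nz by (simp add: complex_vec_def)
  qed
  moreover have "total_degree ?p \<le> 3"
    using total_degree_C_poly[OF total_degree_linear_forms] by (simp add: total_degree_complex_mpoly)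
  moreover have "\<not> total_degree ?p \<le> 2"
    using degree_2_trivial[OF I] calculation(1) by blast
  ultimately show ?thesis
    using I by (intro bexI[of _ ?p]) auto
qed
end

theorem theorem3p4:
  fixes L :: "real ^ 6 \<Rightarrow> real ^ 8"
  assumes "linear L"
    and "bij_betw L UNIV U_space"
    and "\<And>x. norm (L x) = sqrt 2 * norm x"
  shows "zero_set (complex_mpoly ` ideal_J L) = E6_points L
       \<and> radical_ideal (ideal_J L)
       \<and> ((\<exists>p\<in>vanishing_ideal (E6_points L). \<not> trivial_poly p \<and> total_degree p = 3)
         \<and> (\<forall>p\<in>vanishing_ideal (E6_points L). \<not> trivial_poly p \<longrightarrow> 3 \<le> total_degree p))
       \<and> (\<exists>G. ideal_gen G = vanishing_ideal (E6_points L) \<and> (\<forall>p\<in>G. total_degree p \<le> 3))"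
proof -
  interpret E6_embedding L
    by (rule E6_embedding.intro[OF assms])
  have "3 \<le> total_degree p" if "p \<in> vanishing_ideal (E6_points L)" "\<not> trivial_poly p" for p
    using degree_2_trivial[OF that(1)] that(2) by linarith
  then show ?thesis
    using zeros_J J_radical nontrivial_cubic cubic_generators
    by (intro conjI exI[of _ "{p \<in> vanishing_ideal (E6_points L). total_degree p \<le> 3}"] ballI impI) auto
qed
end
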